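(* Let $J(D)$ be the dual of the edge ideal $I(D)$ of a weighted oriented graph $D$. Then $J(D)^n=J(D)^{(n)}$ for all $n\geq 1$ if and only if $J(D)$ is a normal ideal and $\mathrm{NP}(J(D))=\mathrm{IP}(J(D))$.
   Context: Let $G$ be a finite simple graph with vertex set $\{t_1,\ldots,t_s\}$ and edge set $E(G)$. A weighted oriented graph $D$ with underlying graph $G$ is a triple $(V(D),E(D),w)$ where $V(D)=V(G)$, $E(D)\subset V(D)\times V(D)$ satisfies $E(G)=\{\{t_i,t_j\}\mid (t_i,t_j)\in E(D)\}$ and $|E(D)|=|E(G)|$ (so each edge of $G$ receives exactly one direction), and $w\colon V(D)\to\{1,2,3,\ldots\}$ is a weight function; write $w_i=w(t_i)$. Standing convention: every source of $D$ (vertex with only outgoing edges) has weight $1$. Let $K$ be a field and $S=K[t_1,\ldots,t_s]$, with the vertices regarded as variables. The edge ideal of $D$ is $I(D)=(\{t_it_j^{w_j}\mid (t_i,t_j)\in E(D)\})$, and its dual is the ideal $J(D)=\bigcap_{(t_i,t_j)\in E(D)}(t_i,t_j^{w_j})$ of $S$; this expression is the irreducible decomposition of $J(D)$. For an ideal $I$ of $S$ with minimal primes $\mathfrak p_1,\ldots,\mathfrak p_r$ and $n\ge 1$, the $n$-th symbolic power is $I^{(n)}=\bigcap_{i=1}^r (I^nS_{\mathfrak p_i}\cap S)$. The ideal $I$ is normal if $I^n=\overline{I^n}$ for all $n\geq 1$, where $\overline{I^n}$ is the integral closure of $I^n$. For a monomial ideal $I$ with minimal set of monomial generators $\{t^{v_1},\ldots,t^{v_q}\}$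 (where $t^a=t_1^{a_1}\cdots t_s^{a_s}$), the Newton polyhedron is $\mathrm{NP}(I)=\mathbb{R}_+^s+\mathrm{conv}(v_1,\ldots,v_q)$, where $\mathbb{R}_+=\{\lambda\in\mathbb{R}\mid\lambda\ge 0\}$. For $b\in\mathbb{N}^s\setminus\{0\}$ (with $\mathbb{N}=\{0,1,2,\ldots\}$) set $\mathfrak{q}_b=(\{t_i^{b_i}\mid b_i\geq 1\})$ and $b^{-1}=\sum_{b_i\geq 1}b_i^{-1}e_i$, with $e_i$ the $i$-th unit vector of $\mathbb{R}^s$. If $I=\mathfrak{q}_{\alpha_1}\cap\cdots\cap\mathfrak{q}_{\alpha_m}$ is the (unique, irredundant) irreducible decomposition of $I$, the irreducible polyhedron of $I$ is $\mathrm{IP}(I)=\{x\in\mathbb{R}^s\mid x\geq 0,\ xB\geq 1\}$, where $B$ is the $s\times m$ matrix with columns $\alpha_1^{-1},\ldots,\alpha_m^{-1}$, $1=(1,\ldots,1)$, and inequalities are componentwise. *)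

theory Defs
  imports
    "HOL-Analysis.Analysis"
    "HOL-Algebra.Ideal_Product"
    "HOL-Algebra.Algebraic_Closure_Type"
    "HOL-Computational_Algebra.Fraction_Field"
    "HOL-Library.Poly_Mapping"
begin

section \<open>Ideals of a commutative ring\<close>

abbreviation ideal_power :: "('a, 'b) ring_scheme \<Rightarrow> 'a set \<Rightarrow> nat \<Rightarrow> 'a set" where
  "ideal_power R I n \<equiv> I [^]\<^bsub>ideals_set R\<^esub> n"

definition integral_closure :: "('a, 'b) ring_scheme \<Rightarrow> 'a set \<Rightarrow> 'a set" where
  "integral_closure R I =
     {f \<in> carrier R. \<exists>k::nat. k \<ge> 1 \<and>
        (\<exists>a. (\<forall>i\<in>{1..k}. a i \<in> ideal_power R I i) \<and>
             f [^]\<^bsub>R\<^esub> k \<oplus>\<^bsub>R\<^esub> (\<Oplus>\<^bsub>R\<^esub>i\<in>{1..k}. a i \<otimes>\<^bsub>R\<^esub> f [^]\<^bsub>R\<^esub> (k - i)) = \<zero>\<^bsub>R\<^esub>)}"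

definition normal_ideal :: "('a, 'b) ring_scheme \<Rightarrow> 'a set \<Rightarrow> bool" where
  "normal_ideal R I \<longleftrightarrow>
     (\<forall>n\<ge>1. ideal_power R I n = integral_closure R (ideal_power R I n))"

definition minimal_primes :: "('a, 'b) ring_scheme \<Rightarrow> 'a set \<Rightarrow> 'a set set" where
  "minimal_primes R I =
     {P. primeideal P R \<and> I \<subseteq> P \<and> (\<forall>Q. primeideal Q R \<and> I \<subseteq> Q \<and> Q \<subseteq> P \<longrightarrow> Q = P)}"


section \<open>Localization and symbolic powers in an integral domain\<close>

text \<open>The localization of a domain \<open>S\<close> at a prime \<open>P\<close> is realised as the subring of the
  fraction field of \<open>S\<close> consisting of the fractions with denominator outside \<open>P\<close>.\<close>

definition localization :: "'a::idom set \<Rightarrow> 'a fract ring" where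
  "localization P = ring_of_type_algebra \<lparr>carrier := {Fract a s | a s. s \<notin> P}\<rparr>"

definition extended_ideal :: "'a::idom set \<Rightarrow> 'a set \<Rightarrow> 'a fract set" where
  "extended_ideal P I = Idl\<^bsub>localization P\<^esub> ((\<lambda>a. Fract a 1) ` I)"

definition contracted_ideal :: "'a::idom fract set \<Rightarrow> 'a set" where
  "contracted_ideal I = {f. Fract f 1 \<in> I}"

definition symbolic_power :: "'a::idom set \<Rightarrow> nat \<Rightarrow> 'a set" where
  "symbolic_power I n =
     (\<Inter>P\<in>minimal_primes ring_of_type_algebra I.
        contracted_ideal (extended_ideal P (ideal_power ring_of_type_algebra I n)))"


section \<open>The polynomial ring and its monomial ideals\<close>

text \<open>The linear order on the index type of the variables is used only to obtain the instance
  \<^class>\<open>idom\<close> for the type of polynomials.\<close>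

type_synonym 'v expo = "'v \<Rightarrow>\<^sub>0 nat"
type_synonym ('v, 'k) mpoly = "'v expo \<Rightarrow>\<^sub>0 'k"

abbreviation mpoly_ring :: "('v::{finite,linorder}, 'k::field) mpoly ring" where
  "mpoly_ring \<equiv> ring_of_type_algebra"

definition monomial :: "'v::{finite,linorder} expo \<Rightarrow> ('v, 'k::field) mpoly" where
  "monomial a = Poly_Mapping.single a 1"

definition mpoly_var :: "'v::{finite,linorder} \<Rightarrow> ('v, 'k::field) mpoly" where
  "mpoly_var i = monomial (Poly_Mapping.single i 1)"

text \<open>Monomials are represented by their exponent vectors. For a monomial ideal there is exactly one
  inclusion-minimal set of exponents of monomials generating it, and at most one irredundant
  decomposition into the ideals \<open>irreducible_ideal b\<close>, \<open>b \<noteq> 0\<close>; these are the sets selected by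
  the two definite descriptions below.\<close>

definition minimal_monomial_generators ::
  "('v::{finite,linorder}, 'k::field) mpoly set \<Rightarrow> 'v expo set" where
  "minimal_monomial_generators I =
     (THE A. Idl\<^bsub>mpoly_ring\<^esub> (monomial ` A) = I \<and>
             (\<forall>B. B \<subset> A \<longrightarrow> Idl\<^bsub>mpoly_ring\<^esub> (monomial ` B) \<noteq> I))"

definition expo_vec :: "'v::finite expo \<Rightarrow> real ^ 'v" where
  "expo_vec a = (\<chi> i. real (Poly_Mapping.lookup a i))"

definition newton_polyhedron ::
  "('v::{finite,linorder}, 'k::field) mpoly set \<Rightarrow> (real, 'v) vec set" where
  "newton_polyhedron I =
     {x + y | x y. 0 \<le> x \<and> y \<in> convex hull (expo_vec ` minimal_monomial_generators I)}"

definition irreducible_ideal ::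
  "'v::{finite,linorder} expo \<Rightarrow> ('v, 'k::field) mpoly set" where
  "irreducible_ideal b =
     Idl\<^bsub>mpoly_ring\<^esub> {mpoly_var i ^ Poly_Mapping.lookup b i | i. Poly_Mapping.lookup b i \<ge> 1}"

definition irreducible_decomposition ::
  "('v::{finite,linorder}, 'k::field) mpoly set \<Rightarrow> 'v expo set" where
  "irreducible_decomposition I =
     (THE A. finite A \<and> 0 \<notin> A \<and> (\<Inter>b\<in>A. irreducible_ideal b) = I \<and>
             (\<forall>B. B \<subset> A \<longrightarrow> (\<Inter>b\<in>B. irreducible_ideal b) \<noteq> I))"

definition expo_inverse :: "'v::finite expo \<Rightarrow> real ^ 'v" where
  "expo_inverse b =
     (\<chi> i. if Poly_Mapping.lookup b i \<ge> 1 then inverse (real (Poly_Mapping.lookup b i)) else 0)"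

definition irreducible_polyhedron ::
  "('v::{finite,linorder}, 'k::field) mpoly set \<Rightarrow> (real, 'v) vec set" where
  "irreducible_polyhedron I =
     {x. 0 \<le> x \<and> (\<forall>b\<in>irreducible_decomposition I. x \<bullet> expo_inverse b \<ge> 1)}"


section \<open>Weighted oriented graphs\<close>

text \<open>The vertex set is the whole type \<open>'v\<close>; \<open>EG\<close> is the edge set of the underlying simple graph
  and \<open>ED\<close> the set of oriented edges. Equality of the cardinalities says that every edge carries
  exactly one direction. An isolated vertex does not count as a source, so its weight is
  arbitrary.\<close>

locale weighted_oriented_graph =
  fixes EG :: "'v::finite set set" and ED :: "('v \<times> 'v) set" and w :: "'v \<Rightarrow> nat"
  assumes simple: "\<And>e. e \<in> EG \<Longrightarrow> card e = 2"
    and underlying: "EG = {{i, j} | i j. (i, j) \<in> ED}"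
    and one_direction: "card ED = card EG"
    and weight_pos: "\<And>i. w i \<ge> 1"
    and source_weight: "\<And>i. (\<exists>j. (i, j) \<in> ED) \<Longrightarrow> (\<forall>j. (j, i) \<notin> ED) \<Longrightarrow> w i = 1"

definition edge_ideal ::
  "('v::{finite,linorder} \<times> 'v) set \<Rightarrow> ('v \<Rightarrow> nat) \<Rightarrow> ('v, 'k::field) mpoly set" where
  "edge_ideal ED w = Idl\<^bsub>mpoly_ring\<^esub> {mpoly_var i * mpoly_var j ^ w j | i j. (i, j) \<in> ED}"

definition dual_edge_ideal ::
  "('v::{finite,linorder} \<times> 'v) set \<Rightarrow> ('v \<Rightarrow> nat) \<Rightarrow> ('v, 'k::field) mpoly set" where
  "dual_edge_ideal ED w = (\<Inter>(i, j)\<in>ED. Idl\<^bsub>mpoly_ring\<^esub> {mpoly_var i, mpoly_var j ^ w j})"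

end

theory Submission
  imports Defs
begin

text \<open>
  All ideals involved are monomial, so they are described by sets of exponents. The minimal primes of
  \<open>J = J(D)\<close> are the ideals \<open>(t\<^sub>i, t\<^sub>j)\<close> of the edges. Localizing at one of them turns the components of
  the other edges into unit ideals, and the powers of \<open>(t\<^sub>i, t\<^sub>j\<^sup>w)\<close> are primary, so \<open>J\<^sup>(\<^sup>n\<^sup>)\<close> is the
  intersection of the ideals \<open>(t\<^sub>i, t\<^sub>j\<^sup>w)\<^sup>n\<close> (\<open>symbolic_power_dual_edge_ideal\<close>). The decisive property of
  these ideals is that each one is defined by a valuation: give \<open>t\<^sub>i\<close> weight \<open>w\<close> and \<open>t\<^sub>j\<close> weight 1; then
  \<open>(t\<^sub>i, t\<^sub>j\<^sup>w)\<^sup>n\<close> consists of the polynomials of weighted order at least \<open>n w\<close>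
  (\<open>sumset_power_edge_expos\<close>). It follows that \<open>J\<^sup>(\<^sup>n\<^sup>)\<close> is integrally closed and contains the integral
  closure of \<open>J\<^sup>n\<close>, and that its monomials are exactly the lattice points of \<open>n IP(J)\<close>
  (\<open>symbolic_expos_iff_irreducible_polyhedron\<close>).

  Suppose that all ordinary and symbolic powers agree. Then every \<open>J\<^sup>n\<close> is integrally closed. A rational
  point of \<open>IP(J)\<close> with denominator \<open>n\<close> is \<open>1/n\<close> times the exponent of a monomial in \<open>J\<^sup>(\<^sup>n\<^sup>) = J\<^sup>n\<close> and thus
  belongs to \<open>NP(J)\<close>. Since rational points are dense in \<open>IP(J)\<close> and \<open>NP(J)\<close> is closed, \<open>IP(J) \<subseteq> NP(J)\<close>;
  the other inclusion always holds.

  Conversely, let \<open>J\<close> be normal with \<open>NP(J) = IP(J)\<close>, and let \<open>t\<^sup>a\<close> be a monomial of \<open>J\<^sup>(\<^sup>n\<^sup>)\<close>. Then \<open>a\<close> lies in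
  \<open>n NP(J)\<close>, so \<open>a / n\<close> dominates a real convex combination of exponents of generators. By rounding the
  coefficients of multiples of \<open>a\<close> and applying Dickson's lemma to the remainders, one finds \<open>N \<ge> 1\<close> such
  that the \<open>N\<close>-th power of \<open>t\<^sup>a\<close> lies in the \<open>N\<close>-th power of \<open>J\<^sup>n\<close> (\<open>newton_polyhedron_imp_multiple\<close>).
  Hence \<open>t\<^sup>a\<close> is integral over \<open>J\<^sup>n\<close> and lies in \<open>J\<^sup>n\<close> by normality.
\<close>

(* The dollar sign denotes components of vectors below, not coefficients of power series. *)
unbundle no fps_syntax

section \<open>Ideals of a ring given by a type\<close>

lemma type_ring_simps [simp]:
  "carrier (ring_of_type_algebra :: 'a::comm_ring_1 ring) = UNIV"
  "mult (ring_of_type_algebra :: 'a::comm_ring_1 ring) = (*)"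
  "add (ring_of_type_algebra :: 'a::comm_ring_1 ring) = (+)"
  "zero (ring_of_type_algebra :: 'a::comm_ring_1 ring) = 0"
  "one (ring_of_type_algebra :: 'a::comm_ring_1 ring) = 1"
  by (simp_all add: ring_of_type_algebra_def)

lemma type_ring_pow [simp]:
  "x [^]\<^bsub>(ring_of_type_algebra :: 'a::comm_ring_1 ring)\<^esub> (n::nat) = x ^ n"
  by (induction n) (simp_all add: mult.commute)

lemma type_ring_finsum [simp]:
  assumes "finite A"
  shows "finsum (ring_of_type_algebra :: 'a::comm_ring_1 ring) f A = sum f A"
proof -
  interpret cring "ring_of_type_algebra :: 'a ring" ..
  show ?thesis using assms by (induction A) (simp_all add: finsum_insert)
qed

lemma type_ring_ideal_iff:
  "ideal I (ring_of_type_algebra :: 'a::comm_ring_1 ring) \<longleftrightarrow>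
     0 \<in> I \<and> (\<forall>x\<in>I. \<forall>y\<in>I. x + y \<in> I) \<and> (\<forall>x. \<forall>y\<in>I. x * y \<in> I)" (is "?L \<longleftrightarrow> ?R")
proof
  assume ?L
  then interpret ideal I "ring_of_type_algebra :: 'a ring" .
  show ?R
    using additive_subgroup.zero_closed[OF additive_subgroup_axioms]
      additive_subgroup.a_closed[OF additive_subgroup_axioms] I_l_closed by auto
next
  assume R: ?R
  interpret cring "ring_of_type_algebra :: 'a ring" ..
  have neg: "- x \<in> I" if "x \<in> I" for x
    using R that by (metis mult_minus1)
  have right: "x * y \<in> I" if "x \<in> I" for x y
    using R that by (metis mult.commute)
  have inv: "\<ominus>\<^bsub>(ring_of_type_algebra :: 'a ring)\<^esub> x = - x" for x :: 'a
    using minus_equality[of "- x" x] by simp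
  show ?L
  proof (rule idealI)
    show "ring (ring_of_type_algebra :: 'a ring)" ..
    show "subgroup I (add_monoid ring_of_type_algebra)"
      by (rule add.subgroupI) (use R neg inv in auto)
  qed (use R right in auto)
qed

lemma ideal_sum_mem:
  assumes "ideal I (ring_of_type_algebra :: 'a::comm_ring_1 ring)" "\<And>x. x \<in> A \<Longrightarrow> f x \<in> I"
  shows "sum f A \<in> I"
  using assms by (induction A rule: infinite_finite_induct) (auto simp: type_ring_ideal_iff)

lemma type_ring_primeideal_iff:
  "primeideal P (ring_of_type_algebra :: 'a::comm_ring_1 ring) \<longleftrightarrow>
     ideal P ring_of_type_algebra \<and> 1 \<notin> P \<and> (\<forall>x y. x * y \<in> P \<longrightarrow> x \<in> P \<or> y \<in> P)"
  (is "?L \<longleftrightarrow> ?R")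
proof
  assume ?L
  then interpret primeideal P "ring_of_type_algebra :: 'a ring" .
  show ?R
    using one_imp_carrier I_notcarr I_prime is_ideal by auto
next
  assume R: ?R
  show ?L
  proof (rule primeidealI)
    show "cring (ring_of_type_algebra :: 'a ring)" ..
  qed (use R in auto)
qed

lemma primeideal_prod:
  assumes "primeideal P (ring_of_type_algebra :: 'a::comm_ring_1 ring)" "finite A" "prod f A \<in> P"
  obtains x where "x \<in> A" "f x \<in> P"
  using assms(2,3,1) by (induction A) (auto simp: type_ring_primeideal_iff)

lemma primeideal_power:
  assumes "primeideal P (ring_of_type_algebra :: 'a::comm_ring_1 ring)" "x ^ n \<in> P"
  shows "x \<in> P"
  using assms by (induction n) (auto simp: type_ring_primeideal_iff)

lemma genideal_eqI:
  assumes "ideal I (ring_of_type_algebra :: 'a::comm_ring_1 ring)" "A \<subseteq> I"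
    "\<And>K. ideal K ring_of_type_algebra \<Longrightarrow> A \<subseteq> K \<Longrightarrow> I \<subseteq> K"
  shows "Idl\<^bsub>ring_of_type_algebra\<^esub> A = I"
  using assms unfolding genideal_def by blast

lemma ideal_power_0: "ideal_power (ring_of_type_algebra :: 'a::comm_ring_1 ring) I 0 = UNIV"
  by (simp add: ideals_set_def)

lemma ideal_power_Suc:
  "ideal_power R I (Suc n) = ideal_prod R (ideal_power R I n) I"
  by (simp add: ideals_set_def)

lemma ideal_subset_integral_closure:
  assumes I: "ideal I (ring_of_type_algebra :: 'a::comm_ring_1 ring)"
  shows "I \<subseteq> integral_closure ring_of_type_algebra I"
proof
  fix f assume f: "f \<in> I"
  have "(-1) * f \<in> I" using I f unfolding type_ring_ideal_iff by blast
  hence "1 \<otimes>\<^bsub>ring_of_type_algebra\<^esub> (- f) \<in> ideal_prod ring_of_type_algebra UNIV I"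
    by (intro ideal_prod.prod) auto
  hence "- f \<in> ideal_power ring_of_type_algebra I 1"
    unfolding One_nat_def ideal_power_Suc ideal_power_0 by simp
  thus "f \<in> integral_closure ring_of_type_algebra I"
    unfolding integral_closure_def by (auto intro!: exI[of _ 1] exI[of _ "\<lambda>_. - f"])
qed

section \<open>Monomial ideals\<close>

abbreviation lookup :: "('a \<Rightarrow>\<^sub>0 'b::zero) \<Rightarrow> 'a \<Rightarrow> 'b" where
  "lookup \<equiv> Poly_Mapping.lookup"

abbreviation keys :: "('a \<Rightarrow>\<^sub>0 'b::zero) \<Rightarrow> 'a set" where
  "keys \<equiv> Poly_Mapping.keys"

text \<open>A monomial ideal is the span of the monomials in it, so it is determined by an upward closed set
  of exponents; \<open>A + UNIV\<close> is the upward closure of \<open>A\<close>.\<close>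

definition upclosed :: "'v expo set \<Rightarrow> bool" where
  "upclosed M \<longleftrightarrow> M + UNIV = M"

definition span_monomials :: "'v::{finite,linorder} expo set \<Rightarrow> ('v, 'k::field) mpoly set" where
  "span_monomials M = {f. keys f \<subseteq> M}"

lemma upclosed_add: "upclosed M \<Longrightarrow> a \<in> M \<Longrightarrow> a + c \<in> M"
  unfolding upclosed_def by (metis UNIV_I set_plus_intro)

lemma upclosed_iff: "upclosed M \<longleftrightarrow> (\<forall>a\<in>M. \<forall>c. a + c \<in> M)" for M :: "'v expo set"
proof
  assume *: "\<forall>a\<in>M. \<forall>c. a + c \<in> M"
  have "a \<in> M + UNIV" if "a \<in> M" for a
    using set_plus_intro[OF that, of 0 UNIV] by simp
  with * show "upclosed M"
    unfolding upclosed_def by (auto simp: set_plus_def)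
qed (simp add: upclosed_add)

lemma upclosed_plus_UNIV: "upclosed (A + UNIV)" for A :: "'v expo set"
  unfolding upclosed_iff by (auto simp: set_plus_def) (metis add.assoc)

lemma subset_plus_UNIV: "A \<subseteq> A + UNIV" for A :: "'v expo set"
  using set_plus_intro[of _ A 0 UNIV] by fastforce

lemma mem_plus_UNIV_iff:
  "a \<in> A + UNIV \<longleftrightarrow> (\<exists>b\<in>A. \<forall>i. lookup b i \<le> lookup a i)" for A :: "'v expo set"
proof
  assume "\<exists>b\<in>A. \<forall>i. lookup b i \<le> lookup a i"
  then obtain b where b: "b \<in> A" "\<forall>i. lookup b i \<le> lookup a i" by blast
  have "a = b + (a - b)"
    by (rule poly_mapping_eqI) (use b in \<open>simp add: lookup_add lookup_minus\<close>)
  with b(1) show "a \<in> A + UNIV" by (metis UNIV_I set_plus_intro)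
qed (auto simp: set_plus_def lookup_add intro!: bexI[rotated])

lemma keys_monomial [simp]: "keys (monomial a :: ('v::{finite,linorder}, 'k::field) mpoly) = {a}"
  by (simp add: monomial_def)

lemma monomial_mem_span_iff [simp]:
  "(monomial a :: ('v::{finite,linorder}, 'k::field) mpoly) \<in> span_monomials M \<longleftrightarrow> a \<in> M"
  by (simp add: span_monomials_def)

lemma monomial_mult:
  "monomial (a + b) = (monomial a * monomial b :: ('v::{finite,linorder}, 'k::field) mpoly)"
  by (simp add: monomial_def mult_single)

lemma monomial_0 [simp]: "monomial 0 = (1 :: ('v::{finite,linorder}, 'k::field) mpoly)"
  by (simp add: monomial_def)

lemma monomial_power:
  "(monomial a :: ('v::{finite,linorder}, 'k::field) mpoly) ^ n = monomial (\<Sum>_<n. a)" for n :: nat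
  by (induction n) (simp_all add: monomial_mult mult.commute)

lemma mpoly_var_power:
  "(mpoly_var i :: ('v::{finite,linorder}, 'k::field) mpoly) ^ n = monomial (Poly_Mapping.single i n)"
  by (induction n) (simp_all add: mpoly_var_def flip: monomial_mult single_add)

lemma span_monomials_mult:
  assumes "f \<in> span_monomials M" "g \<in> span_monomials N"
  shows "f * g \<in> span_monomials (M + N)"
  using assms keys_mult[of f g] unfolding span_monomials_def by (fastforce simp: set_plus_def)

lemma span_monomials_add:
  "f \<in> span_monomials M \<Longrightarrow> g \<in> span_monomials M \<Longrightarrow> f + g \<in> span_monomials M"
  using Poly_Mapping.keys_add[of f g] by (auto simp: span_monomials_def)

lemma span_monomials_UNIV [simp]: "span_monomials UNIV = UNIV"
  by (simp add: span_monomials_def)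

lemma span_monomials_eq_iff [simp]:
  "(span_monomials M :: ('v::{finite,linorder}, 'k::field) mpoly set) = span_monomials N \<longleftrightarrow> M = N"
proof
  assume *: "(span_monomials M :: ('v, 'k) mpoly set) = span_monomials N"
  have "a \<in> M \<longleftrightarrow> a \<in> N" for a
    using monomial_mem_span_iff[where 'k='k, of a] * by metis
  thus "M = N" by blast
qed auto

lemma span_monomials_absorb:
  assumes "upclosed M" "g \<in> span_monomials M"
  shows "f * g \<in> span_monomials M"
  using span_monomials_mult[of g M f UNIV] assms by (simp add: upclosed_def mult.commute)

lemma ideal_span_monomials:
  assumes "upclosed M"
  shows "ideal (span_monomials M :: ('v::{finite,linorder}, 'k::field) mpoly set) mpoly_ring"
  unfolding type_ring_ideal_iff
  using assms by (auto intro: span_monomials_add span_monomials_absorb) (simp add: span_monomials_def)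

lemma mpoly_eq_sum_monomials:
  fixes f :: "('v::{finite,linorder}, 'k::field) mpoly"
  shows "f = (\<Sum>a\<in>keys f. Poly_Mapping.single 0 (lookup f a) * monomial a)"
proof (rule poly_mapping_eqI)
  fix b
  have "(\<Sum>a\<in>keys f. if a = b then lookup f a else 0) = lookup f b"
    by (simp add: in_keys_iff)
  thus "lookup f b = lookup (\<Sum>a\<in>keys f. Poly_Mapping.single 0 (lookup f a) * monomial a) b"
    by (simp add: monomial_def mult_single lookup_sum lookup_single when_def)
qed

lemma span_monomials_subset_ideal:
  fixes I :: "('v::{finite,linorder}, 'k::field) mpoly set"
  assumes "ideal I mpoly_ring" "monomial ` M \<subseteq> I"
  shows "span_monomials M \<subseteq> I"
proof
  fix f :: "('v, 'k) mpoly" assume "f \<in> span_monomials M"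
  hence "(\<Sum>a\<in>keys f. Poly_Mapping.single 0 (lookup f a) * monomial a) \<in> I"
    using assms unfolding type_ring_ideal_iff span_monomials_def
    by (intro ideal_sum_mem[unfolded type_ring_ideal_iff]) blast+
  thus "f \<in> I" using mpoly_eq_sum_monomials[of f] by simp
qed

lemma genideal_monomials:
  "Idl\<^bsub>mpoly_ring\<^esub> (monomial ` A) =
     (span_monomials (A + UNIV) :: ('v::{finite,linorder}, 'k::field) mpoly set)"
proof (rule genideal_eqI)
  fix K :: "('v, 'k) mpoly set"
  assume K: "ideal K mpoly_ring" "monomial ` A \<subseteq> K"
  have "(monomial (a + c) :: ('v, 'k) mpoly) \<in> K" if "a \<in> A" for a c
    using K that unfolding type_ring_ideal_iff by (metis add.commute imageI monomial_mult subsetD)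
  hence "monomial ` (A + UNIV) \<subseteq> K"
    by (auto simp: set_plus_def)
  thus "span_monomials (A + UNIV) \<subseteq> K"
    by (rule span_monomials_subset_ideal[OF K(1)])
qed (use subset_plus_UNIV[of A] in \<open>auto simp: ideal_span_monomials upclosed_plus_UNIV\<close>)

text \<open>Both sides are ideals and the generators of the right-hand side are products of monomials, so that
  products of monomial ideals are computed on exponents.\<close>

lemma ideal_prod_span_monomials:
  assumes "upclosed M" "upclosed N"
  shows "ideal_prod mpoly_ring (span_monomials M) (span_monomials N) =
         (span_monomials (M + N) :: ('v::{finite,linorder}, 'k::field) mpoly set)" (is "?L = ?R")
proof
  show "?L \<subseteq> ?R"
  proof
    fix f assume "f \<in> ?L"
    thus "f \<in> ?R"
      by induction (auto intro: span_monomials_mult span_monomials_add)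
  qed
  show "?R \<subseteq> ?L"
  proof (rule span_monomials_subset_ideal)
    show "ideal ?L mpoly_ring"
      by (rule ring.ideal_prod_is_ideal) (auto intro: ideal_span_monomials assms)
    show "monomial ` (M + N) \<subseteq> ?L"
    proof clarify
      fix c assume "c \<in> M + N"
      then obtain a b where ab: "a \<in> M" "b \<in> N" "c = a + b" by (auto simp: set_plus_def)
      have "(monomial a \<otimes>\<^bsub>mpoly_ring\<^esub> monomial b :: ('v, 'k) mpoly) \<in> ?L"
        by (rule ideal_prod.prod) (use ab in auto)
      thus "(monomial c :: ('v, 'k) mpoly) \<in> ?L" by (simp add: ab monomial_mult)
    qed
  qed
qed

text \<open>The exponents of the \<open>n\<close>-th power of a monomial ideal. The power 0 is the whole monoid, because
  the 0-th power of an ideal is the unit ideal; in particular \<open>sumset_power M 1 = M + UNIV\<close>.\<close>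

primrec sumset_power :: "'v expo set \<Rightarrow> nat \<Rightarrow> 'v expo set" where
  "sumset_power M 0 = UNIV"
| "sumset_power M (Suc n) = sumset_power M n + M"

lemma upclosed_sumset_power: "upclosed M \<Longrightarrow> upclosed (sumset_power M n)"
proof (induction n)
  case (Suc n)
  thus ?case by (simp add: upclosed_def add.assoc)
qed (simp add: upclosed_iff)

lemma ideal_power_span_monomials:
  assumes "upclosed M"
  shows "ideal_power mpoly_ring (span_monomials M) n =
         (span_monomials (sumset_power M n) :: ('v::{finite,linorder}, 'k::field) mpoly set)"
proof (induction n)
  case (Suc n)
  thus ?case
    unfolding ideal_power_Suc by (simp add: ideal_prod_span_monomials assms upclosed_sumset_power)
qed (simp only: ideal_power_0 sumset_power.simps span_monomials_UNIV)

lemma sumset_power_mono: "M \<subseteq> N \<Longrightarrow> sumset_power M n \<subseteq> sumset_power N n"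
  by (induction n) (simp_all add: set_plus_mono2)

lemma sumset_power_add:
  assumes "upclosed M"
  shows "sumset_power M (m + n) = sumset_power M m + sumset_power M n"
proof (induction n)
  case 0
  show ?case using upclosed_sumset_power[OF assms] by (simp add: upclosed_def)
next
  case (Suc n)
  thus ?case by (simp add: add.assoc)
qed

lemma sumset_power_mult:
  assumes "upclosed M"
  shows "sumset_power (sumset_power M m) n = sumset_power M (m * n)"
  using assms by (induction n) (simp_all add: sumset_power_add add.commute)

lemma sumset_power_1:
  assumes "upclosed M"
  shows "sumset_power M (Suc 0) = M"
  using assms by (simp add: upclosed_def add.commute)

text \<open>The monomial is a root of \<open>X\<^sup>N - c\<close>, where the constant \<open>c\<close> is its \<open>N\<close>-th power, and the
  hypothesis says that this is an equation of integral dependence.\<close>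

lemma monomial_integral:
  fixes M :: "'v::{finite,linorder} expo set"
  assumes "upclosed M" "N \<ge> 1" "(\<Sum>_<N. a) \<in> sumset_power M N"
  shows "monomial a \<in> integral_closure mpoly_ring (span_monomials M :: ('v, 'k::field) mpoly set)"
proof -
  let ?c = "\<lambda>i. if i = N then - ((monomial a :: ('v, 'k) mpoly) ^ N) else 0"
  have ideal: "ideal (span_monomials (sumset_power M i) :: ('v, 'k) mpoly set) mpoly_ring" for i
    by (intro ideal_span_monomials upclosed_sumset_power assms)
  have "(monomial a :: ('v, 'k) mpoly) ^ N \<in> span_monomials (sumset_power M N)"
    using assms by (simp add: monomial_power)
  hence "- ((monomial a :: ('v, 'k) mpoly) ^ N) \<in> span_monomials (sumset_power M N)"
    by (simp add: span_monomials_def)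
  hence "?c i \<in> ideal_power mpoly_ring (span_monomials M) i" for i
    using ideal[of i] by (simp add: ideal_power_span_monomials assms type_ring_ideal_iff)
  moreover have "(\<Sum>i\<in>{1..N}. ?c i * monomial a ^ (N - i)) =
      (\<Sum>i\<in>{1..N}. if i = N then - ((monomial a :: ('v, 'k) mpoly) ^ N) else 0)"
    by (rule sum.cong) auto
  ultimately show ?thesis
    unfolding integral_closure_def using assms(2)
    by (auto intro!: exI[of _ N] exI[of _ ?c])
qed

section \<open>Weighted orders of polynomials\<close>

definition weight :: "('v::finite \<Rightarrow> nat) \<Rightarrow> 'v expo \<Rightarrow> nat" where
  "weight c a = (\<Sum>i\<in>UNIV. c i * lookup a i)"

definition order_ideal ::
  "('v::{finite,linorder} \<Rightarrow> nat) \<Rightarrow> nat \<Rightarrow> ('v, 'k::field) mpoly set" where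
  "order_ideal c d = span_monomials {a. d \<le> weight c a}"

text \<open>The value is meaningful only for nonzero polynomials; \<open>order_ideal c d\<close> contains 0 for every \<open>d\<close>.\<close>

definition weighted_order ::
  "('v::{finite,linorder} \<Rightarrow> nat) \<Rightarrow> ('v, 'k::field) mpoly \<Rightarrow> nat" where
  "weighted_order c f = Min (weight c ` keys f)"

lemma weight_add: "weight c (a + b) = weight c a + weight c b"
  by (simp add: weight_def lookup_add algebra_simps sum.distrib)

lemma upclosed_weight: "upclosed {a. d \<le> weight c a}"
  by (auto simp: upclosed_iff weight_add)

lemma ideal_order_ideal: "ideal (order_ideal c d :: ('v::{finite,linorder}, 'k::field) mpoly set) mpoly_ring"
  unfolding order_ideal_def by (intro ideal_span_monomials upclosed_weight)

lemma order_ideal_0 [simp]: "order_ideal c 0 = UNIV"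
  by (simp add: order_ideal_def)

lemma mem_order_ideal_iff:
  "f \<in> order_ideal c d \<longleftrightarrow> f = 0 \<or> d \<le> weighted_order c f"
  by (cases "f = 0") (auto simp: order_ideal_def span_monomials_def weighted_order_def keys_eq_empty)

lemma order_ideal_mult:
  assumes "f \<in> order_ideal c d" "g \<in> order_ideal c e"
  shows "f * g \<in> order_ideal c (d + e)"
proof -
  have "{a. d \<le> weight c a} + {a. e \<le> weight c a} \<subseteq> {a. d + e \<le> weight c a}"
    by (auto simp: set_plus_def weight_add)
  moreover have "f * g \<in> span_monomials ({a. d \<le> weight c a} + {a. e \<le> weight c a})"
    using assms unfolding order_ideal_def by (rule span_monomials_mult)
  ultimately show ?thesis unfolding order_ideal_def span_monomials_def by blast
qed

text \<open>The initial form collects the terms of least weight; what remains has strictly larger order.\<close>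

lemma initial_form:
  fixes f :: "('v::{finite,linorder}, 'k::field) mpoly"
  assumes "f \<noteq> 0"
  obtains f0 f1 where "f = f0 + f1" "f0 \<noteq> 0" "f0 \<in> span_monomials {a. weight c a = weighted_order c f}"
    "f1 \<in> order_ideal c (Suc (weighted_order c f))"
proof
  define f0 :: "('v, 'k) mpoly" where
    "f0 = (\<Sum>a\<in>{a\<in>keys f. weight c a = weighted_order c f}. Poly_Mapping.single a (lookup f a))"
  have lookup_f0: "lookup f0 a = (if weight c a = weighted_order c f then lookup f a else 0)" for a
  proof -
    have "lookup f0 a = (\<Sum>b\<in>{b\<in>keys f. weight c b = weighted_order c f}. if b = a then lookup f a else 0)"
      unfolding f0_def lookup_sum by (rule sum.cong) (auto simp: lookup_single when_def)
    also have "\<dots> = (if weight c a = weighted_order c f then lookup f a else 0)"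
      by (auto simp: in_keys_iff)
    finally show ?thesis .
  qed
  show "f = f0 + (f - f0)" by simp
  have "keys f \<noteq> {}" using assms by (simp add: keys_eq_empty)
  hence "weighted_order c f \<in> weight c ` keys f"
    unfolding weighted_order_def by (intro Min_in) auto
  then obtain a where "a \<in> keys f" "weight c a = weighted_order c f" by auto
  hence "lookup f0 a \<noteq> 0" by (simp add: lookup_f0 in_keys_iff)
  thus "f0 \<noteq> 0" by auto
  show "f0 \<in> span_monomials {a. weight c a = weighted_order c f}"
    by (auto simp: span_monomials_def in_keys_iff lookup_f0 split: if_splits)
  have "Suc (weighted_order c f) \<le> weight c b" if "b \<in> keys (f - f0)" for b
  proof -
    have "weight c b \<noteq> weighted_order c f" "b \<in> keys f"
      using that by (auto simp: in_keys_iff lookup_minus lookup_f0 split: if_splits)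
    moreover from \<open>b \<in> keys f\<close> have "weighted_order c f \<le> weight c b"
      unfolding weighted_order_def by (intro Min_le) auto
    ultimately show ?thesis by simp
  qed
  thus "f - f0 \<in> order_ideal c (Suc (weighted_order c f))"
    by (auto simp: order_ideal_def span_monomials_def)
qed

text \<open>A weighted order is a valuation because the product of the initial forms, which does not
  vanish in a domain, is the initial form of the product.\<close>

lemma weighted_order_mult:
  fixes f g :: "('v::{finite,linorder}, 'k::field) mpoly"
  assumes "f \<noteq> 0" "g \<noteq> 0"
  shows "weighted_order c (f * g) = weighted_order c f + weighted_order c g" (is "_ = ?d + ?e")
proof -
  obtain f0 f1 where f: "f = f0 + f1" "f0 \<noteq> 0" "f0 \<in> span_monomials {a. weight c a = ?d}"
    "f1 \<in> order_ideal c (Suc ?d)" by (rule initial_form[OF assms(1)])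
  obtain g0 g1 where g: "g = g0 + g1" "g0 \<noteq> 0" "g0 \<in> span_monomials {a. weight c a = ?e}"
    "g1 \<in> order_ideal c (Suc ?e)" by (rule initial_form[OF assms(2)])
  have fg: "f * g = f0 * g0 + (f0 * g1 + f1 * g)"
    by (simp add: f(1) g(1) algebra_simps)
  have f0: "f0 \<in> order_ideal c ?d"
    using f(3) by (auto simp: order_ideal_def span_monomials_def)
  have g': "g \<in> order_ideal c ?e" by (simp add: mem_order_ideal_iff)
  have rest: "f0 * g1 + f1 * g \<in> order_ideal c (Suc (?d + ?e))"
    using order_ideal_mult[OF f0 g(4)] order_ideal_mult[OF f(4) g']
    unfolding order_ideal_def by (intro span_monomials_add) auto
  have hom: "f0 * g0 \<in> span_monomials {a. weight c a = ?d + ?e}"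
  proof -
    have "{a. weight c a = ?d} + {a. weight c a = ?e} \<subseteq> {a. weight c a = ?d + ?e}"
      by (auto simp: set_plus_def weight_add)
    thus ?thesis using span_monomials_mult[OF f(3) g(3)] unfolding span_monomials_def by blast
  qed
  have "f0 * g0 \<noteq> 0" using f(2) g(2) by simp
  then obtain a where a: "a \<in> keys (f0 * g0)" using keys_eq_empty by blast
  have "f * g \<notin> order_ideal c (Suc (?d + ?e))"
  proof
    assume "f * g \<in> order_ideal c (Suc (?d + ?e))"
    hence "f * g + (- (f0 * g1 + f1 * g)) \<in> order_ideal c (Suc (?d + ?e))"
      using rest unfolding order_ideal_def
      by (intro span_monomials_add) (simp_all add: span_monomials_def del: minus_add_distrib)
    hence "f0 * g0 \<in> order_ideal c (Suc (?d + ?e))" by (simp add: fg)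
    with a hom show False by (fastforce simp: order_ideal_def span_monomials_def)
  qed
  moreover have "f * g \<in> order_ideal c (?d + ?e)"
    by (rule order_ideal_mult) (auto simp: mem_order_ideal_iff)
  ultimately show ?thesis
    by (auto simp: mem_order_ideal_iff)
qed

lemma weighted_order_one [simp]: "weighted_order c (1 :: ('v::{finite,linorder}, 'k::field) mpoly) = 0"
  by (simp add: weighted_order_def weight_def)

lemma weighted_order_power:
  fixes f :: "('v::{finite,linorder}, 'k::field) mpoly"
  shows "f \<noteq> 0 \<Longrightarrow> weighted_order c (f ^ n) = n * weighted_order c f"
  by (induction n) (simp_all add: weighted_order_mult)

text \<open>This yields all the primes needed: the ideal is generated by the variables of
  positive weight.\<close>

lemma primeideal_order_ideal_1:
  "primeideal (order_ideal c 1 :: ('v::{finite,linorder}, 'k::field) mpoly set) mpoly_ring"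
  unfolding type_ring_primeideal_iff
proof (intro conjI allI impI ideal_order_ideal)
  show "(1 :: ('v, 'k) mpoly) \<notin> order_ideal c 1" by (simp add: mem_order_ideal_iff)
  fix x y :: "('v, 'k) mpoly" assume "x * y \<in> order_ideal c 1"
  thus "x \<in> order_ideal c 1 \<or> y \<in> order_ideal c 1"
    by (cases "x = 0 \<or> y = 0") (auto simp: mem_order_ideal_iff weighted_order_mult)
qed

text \<open>If \<open>f\<close> had order less than \<open>d\<close>, then \<open>f\<^sup>k\<close> would be the only term of least order in an equation
  of integral dependence of degree \<open>k\<close>.\<close>

lemma integral_closure_subset_order_ideal:
  fixes I :: "('v::{finite,linorder}, 'k::field) mpoly set"
  assumes "\<And>i. ideal_power mpoly_ring I i \<subseteq> order_ideal c (i * d)"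
  shows "integral_closure mpoly_ring I \<subseteq> order_ideal c d"
proof
  fix f assume "f \<in> integral_closure mpoly_ring I"
  then obtain k a where k: "k \<ge> 1" and a': "\<forall>i\<in>{1..k}. a i \<in> ideal_power mpoly_ring I i"
    and eq: "f ^ k + (\<Sum>i\<in>{1..k}. a i * f ^ (k - i)) = 0"
    unfolding integral_closure_def by auto
  note a = bspec[OF a']
  show "f \<in> order_ideal c d"
  proof (rule ccontr)
    assume f: "f \<notin> order_ideal c d"
    define e where "e = weighted_order c f"
    have f0: "f \<noteq> 0" and ed: "e < d" using f by (auto simp: mem_order_ideal_iff e_def)
    have "a i * f ^ (k - i) \<in> order_ideal c (Suc (k * e))" if i: "i \<in> {1..k}" for i
    proof -
      have "a i * f ^ (k - i) \<in> order_ideal c (i * d + (k - i) * e)"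
        using a[OF i] assms[of i]
        by (intro order_ideal_mult) (auto simp: mem_order_ideal_iff weighted_order_power f0 e_def)
      moreover have "Suc (k * e) \<le> i * d + (k - i) * e"
      proof -
        have "k * e = i * e + (k - i) * e" using i by (simp flip: add_mult_distrib)
        moreover have "i * e < i * d" using i ed by simp
        ultimately show ?thesis by (metis Suc_leI add_less_mono1)
      qed
      ultimately show ?thesis by (auto simp: mem_order_ideal_iff)
    qed
    hence "(\<Sum>i\<in>{1..k}. a i * f ^ (k - i)) \<in> order_ideal c (Suc (k * e))"
      by (intro ideal_sum_mem[OF ideal_order_ideal])
    hence "- (\<Sum>i\<in>{1..k}. a i * f ^ (k - i)) \<in> order_ideal c (Suc (k * e))"
      by (simp add: order_ideal_def span_monomials_def)
    moreover have "f ^ k = - (\<Sum>i\<in>{1..k}. a i * f ^ (k - i))"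
      using eq by (rule eq_neg_iff_add_eq_0[THEN iffD2])
    ultimately have "f ^ k \<in> order_ideal c (Suc (k * e))" by simp
    thus False
      using f0 by (simp add: mem_order_ideal_iff weighted_order_power flip: e_def)
  qed
qed

section \<open>The components of the dual ideal\<close>

text \<open>For the ideal \<open>(t\<^sub>i, t\<^sub>j\<^sup>m)\<close> the relevant valuation gives \<open>t\<^sub>i\<close> weight \<open>m\<close> and \<open>t\<^sub>j\<close> weight 1:
  the powers of the ideal are exactly the ideals of order at least \<open>n m\<close>.\<close>

definition edge_weights :: "'v \<Rightarrow> 'v \<Rightarrow> nat \<Rightarrow> 'v \<Rightarrow> nat" where
  "edge_weights i j m = (\<lambda>k. if k = i then m else if k = j then 1 else 0)"

definition edge_expos :: "'v \<Rightarrow> 'v \<Rightarrow> nat \<Rightarrow> 'v expo set" where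
  "edge_expos i j m = {a. 1 \<le> lookup a i \<or> m \<le> lookup a j}"

lemma weight_edge_weights:
  assumes "i \<noteq> j"
  shows "weight (edge_weights i j m) a = m * lookup a i + lookup (a :: 'v::finite expo) j"
proof -
  have "weight (edge_weights i j m) a =
      (\<Sum>k\<in>UNIV. (if k = i then m * lookup a i else 0) + (if k = j then lookup a j else 0))"
    unfolding weight_def by (rule sum.cong) (use assms in \<open>auto simp: edge_weights_def\<close>)
  thus ?thesis by (simp add: sum.distrib)
qed

lemma upclosed_edge_expos: "upclosed (edge_expos i j m)"
  by (auto simp: upclosed_iff edge_expos_def lookup_add)

lemma expo_split_single:
  fixes a :: "'v expo"
  assumes "n \<le> lookup a i"
  obtains b where "a = b + Poly_Mapping.single i n"
proof
  show "a = (a - Poly_Mapping.single i n) + Poly_Mapping.single i n"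
    by (rule poly_mapping_eqI) (use assms in \<open>auto simp: lookup_add lookup_minus lookup_single when_def\<close>)
qed

lemma edge_genideal:
  "Idl\<^bsub>mpoly_ring\<^esub> {mpoly_var i, mpoly_var j ^ m} =
     (span_monomials (edge_expos i j m) :: ('v::{finite,linorder}, 'k::field) mpoly set)"
proof -
  have "{mpoly_var i, mpoly_var j ^ m} =
      (monomial ` {Poly_Mapping.single i 1, Poly_Mapping.single j m} :: ('v, 'k) mpoly set)"
    by (simp add: mpoly_var_power) (simp add: mpoly_var_def)
  moreover have "{Poly_Mapping.single i 1, Poly_Mapping.single j m} + UNIV = edge_expos i j m"
    by (rule Set.set_eqI, unfold mem_plus_UNIV_iff)
       (auto simp: edge_expos_def lookup_single when_def split: if_splits)
  ultimately show ?thesis by (simp only: genideal_monomials)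
qed

text \<open>The weight \<open>m a\<^sub>i + a\<^sub>j\<close> is an integer combination in which \<open>a\<^sub>i\<close> has the coefficient \<open>m\<close>, so the real
  inequality \<open>a\<^sub>i + a\<^sub>j / m \<ge> n\<close> already forces \<open>a\<^sub>i + \<lfloor>a\<^sub>j / m\<rfloor> \<ge> n\<close>: a factor \<open>t\<^sub>i\<close> or \<open>t\<^sub>j\<^sup>m\<close> can be split off
  as long as \<open>n > 0\<close>. This is why every power of the ideal is integrally closed.\<close>

lemma sumset_power_edge_expos:
  assumes "i \<noteq> j" "m \<ge> 1"
  shows "sumset_power (edge_expos i j m) n =
         {a :: 'v::finite expo. n * m \<le> weight (edge_weights i j m) a}"
proof (induction n)
  case (Suc n)
  have *: "edge_expos i j m = {a. m \<le> weight (edge_weights i j m) a}"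
  proof (rule Set.set_eqI)
    fix a :: "'v expo"
    show "a \<in> edge_expos i j m \<longleftrightarrow> a \<in> {a. m \<le> weight (edge_weights i j m) a}"
      by (cases "lookup a i") (simp_all add: edge_expos_def weight_edge_weights[OF assms(1)])
  qed
  have 1: "sumset_power (edge_expos i j m) (Suc n) \<subseteq> {a. Suc n * m \<le> weight (edge_weights i j m) a}"
    unfolding sumset_power.simps Suc.IH unfolding * by (auto simp: set_plus_def weight_add)
  have 2: "a \<in> sumset_power (edge_expos i j m) (Suc n)" if a: "Suc n * m \<le> weight (edge_weights i j m) a" for a
  proof (cases "1 \<le> lookup a i")
    case True
    then obtain b where b: "a = b + Poly_Mapping.single i 1" by (rule expo_split_single)
    have "b \<in> sumset_power (edge_expos i j m) n"
      using a assms(2) unfolding Suc.IH by (simp add: b weight_add weight_edge_weights[OF assms(1)] lookup_single assms(1) assms(1)[symmetric])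
    moreover have "Poly_Mapping.single i 1 \<in> edge_expos i j m" by (simp add: edge_expos_def)
    ultimately show ?thesis by (simp add: b set_plus_intro)
  next
    case False
    hence "lookup a i = 0" by simp
    with a have a': "Suc n * m \<le> lookup a j" by (simp add: weight_edge_weights[OF assms(1)])
    hence "m \<le> lookup a j" by simp
    then obtain b where b: "a = b + Poly_Mapping.single j m" by (rule expo_split_single)
    have "b \<in> sumset_power (edge_expos i j m) n"
      using a unfolding Suc.IH by (simp add: b weight_add weight_edge_weights[OF assms(1)] lookup_single assms(1) assms(1)[symmetric])
    moreover have "Poly_Mapping.single j m \<in> edge_expos i j m" by (simp add: edge_expos_def)
    ultimately show ?thesis by (simp add: b set_plus_intro)
  qed
  from 1 2 show ?case by blast
qed simp

section \<open>Contraction of localized ideals\<close>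

text \<open>Localizations are subrings of the fraction field, so the criterion is needed relative to a carrier.\<close>

lemma subring_ideal_iff:
  fixes H :: "'a::comm_ring_1 set"
  assumes "subring H ring_of_type_algebra"
  shows "ideal I (ring_of_type_algebra\<lparr>carrier := H\<rparr>) \<longleftrightarrow>
     I \<subseteq> H \<and> 0 \<in> I \<and> (\<forall>x\<in>I. \<forall>y\<in>I. x + y \<in> I) \<and> (\<forall>x\<in>H. \<forall>y\<in>I. x * y \<in> I)" (is "?L \<longleftrightarrow> ?R")
proof
  assume ?L
  then interpret ideal I "ring_of_type_algebra\<lparr>carrier := H\<rparr>" .
  show ?R
    using additive_subgroup.zero_closed[OF additive_subgroup_axioms]
      additive_subgroup.a_closed[OF additive_subgroup_axioms] I_l_closed a_subset by auto
next
  assume R: ?R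
  interpret T: ring "ring_of_type_algebra :: 'a ring" ..
  interpret ring "ring_of_type_algebra\<lparr>carrier := H\<rparr>"
    by (rule T.subring_is_ring[OF assms])
  have right: "x * y \<in> I" if "x \<in> I" "y \<in> H" for x y
    using R that by (metis mult.commute)
  have H: "0 \<in> H" "1 \<in> H" and minus: "- x \<in> H" if "x \<in> H" for x
  proof -
    have m: "\<ominus>\<^bsub>(ring_of_type_algebra :: 'a ring)\<^esub> x = - x" for x :: 'a
      using T.minus_equality[of "- x" x] by simp
    show "0 \<in> H" "1 \<in> H"
      using zero_closed one_closed by auto
    show "- x \<in> H"
      using subringE(5)[OF assms that] by (simp add: m)
  qed
  have inv: "\<ominus>\<^bsub>ring_of_type_algebra\<lparr>carrier := H\<rparr>\<^esub> x = - x" if "x \<in> H" for x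
    using minus_equality[of "- x" x] that minus by simp
  have neg: "- x \<in> I" if "x \<in> I" for x
    using R that minus[of 1] H(2) that by (metis mult_minus1 subsetD)
  show ?L
  proof (rule idealI)
    show "subgroup I (add_monoid (ring_of_type_algebra\<lparr>carrier := H\<rparr>))"
    proof (rule add.subgroupI)
      fix x assume "x \<in> I"
      with R have "x \<in> H" "x \<in> I" by auto
      thus "\<ominus>\<^bsub>ring_of_type_algebra\<lparr>carrier := H\<rparr>\<^esub> x \<in> I" by (simp only: inv neg)
    qed (use R in auto)
  qed (use R right in \<open>auto simp: ring_axioms\<close>)
qed

lemma subring_localization:
  assumes P: "primeideal P (ring_of_type_algebra :: 'a::idom ring)"
  shows "subring {Fract a s | a s. s \<notin> P} ring_of_type_algebra"
proof -
  interpret ring "ring_of_type_algebra :: 'a fract ring" ..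
  have m: "\<ominus>\<^bsub>(ring_of_type_algebra :: 'a fract ring)\<^esub> x = - x" for x :: "'a fract"
    using minus_equality[of "- x" x] by simp
  have P: "0 \<in> P" "1 \<notin> P" "\<And>x y. x \<notin> P \<Longrightarrow> y \<notin> P \<Longrightarrow> x * y \<notin> P"
    using P by (auto simp: type_ring_primeideal_iff type_ring_ideal_iff)
  show ?thesis
  proof (rule subringI)
    show "\<one>\<^bsub>ring_of_type_algebra\<^esub> \<in> {Fract a s | a s. s \<notin> P}"
      using P by (auto simp: One_fract_def)
  next
    fix h1 h2 assume "h1 \<in> {Fract a s | a s. s \<notin> P}" "h2 \<in> {Fract a s | a s. s \<notin> P}"
    then obtain a s b t where *: "h1 = Fract a s" "s \<notin> P" "h2 = Fract b t" "t \<notin> P" by blast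
    hence "s \<noteq> 0" "t \<noteq> 0" using P by auto
    thus "h1 \<oplus>\<^bsub>ring_of_type_algebra\<^esub> h2 \<in> {Fract a s | a s. s \<notin> P}"
      using P(3)[OF *(2,4)] by (auto simp: *)
    show "h1 \<otimes>\<^bsub>ring_of_type_algebra\<^esub> h2 \<in> {Fract a s | a s. s \<notin> P}"
      using P(3)[OF *(2,4)] by (auto simp: *)
  next
    fix h assume "h \<in> {Fract a s | a s. s \<notin> P}"
    thus "\<ominus>\<^bsub>ring_of_type_algebra\<^esub> h \<in> {Fract a s | a s. s \<notin> P}"
      by (auto simp: m) blast
  qed simp
qed

text \<open>Every element of the extended ideal is a single fraction with numerator in \<open>I\<close>, as common
  denominators exist.\<close>

lemma contracted_extended_ideal:
  fixes P I :: "'a::idom set"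
  assumes P: "primeideal P ring_of_type_algebra" and I: "ideal I ring_of_type_algebra"
  shows "contracted_ideal (extended_ideal P I) = {f. \<exists>s. s \<notin> P \<and> s * f \<in> I}"
proof -
  let ?H = "{Fract a s | a s. s \<notin> P}"
  note sub = subring_localization[OF P]
  interpret T: ring "ring_of_type_algebra :: 'a fract ring" ..
  interpret L: ring "localization P"
    unfolding localization_def by (rule T.subring_is_ring[OF sub])
  have P: "0 \<in> P" "1 \<notin> P" "\<And>x y. x \<notin> P \<Longrightarrow> y \<notin> P \<Longrightarrow> x * y \<notin> P"
    using P by (auto simp: type_ring_primeideal_iff type_ring_ideal_iff)
  have I: "0 \<in> I" "\<And>x y. x \<in> I \<Longrightarrow> y \<in> I \<Longrightarrow> x + y \<in> I" "\<And>x y. y \<in> I \<Longrightarrow> x * y \<in> I"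
    using I by (auto simp: type_ring_ideal_iff)
  have carrier: "carrier (localization P) = ?H"
    by (simp add: localization_def)
  have gen: "(\<lambda>a. Fract a 1) ` I \<subseteq> carrier (localization P)"
    using P by (auto simp: carrier)
  have ext: "ideal (extended_ideal P I) (localization P)"
    unfolding extended_ideal_def by (rule L.genideal_ideal[OF gen])
  have frac: "ideal {Fract a s | a s. a \<in> I \<and> s \<notin> P} (localization P)" (is "ideal ?F _")
    unfolding localization_def subring_ideal_iff[OF sub]
  proof (intro conjI ballI)
    show "0 \<in> ?F" using I(1) P(2) by (auto simp: Zero_fract_def)
  next
    fix x y assume "x \<in> ?F" "y \<in> ?F"
    then obtain a s b t where *: "x = Fract a s" "a \<in> I" "s \<notin> P" "y = Fract b t" "b \<in> I" "t \<notin> P"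
      by blast
    hence "s \<noteq> 0" "t \<noteq> 0" using P by auto
    moreover have "a * t + b * s \<in> I" using I *(2,5) by (metis mult.commute)
    ultimately show "x + y \<in> ?F" using P(3)[OF *(3,6)] by (auto simp: *)
  next
    fix x y assume "x \<in> ?H" "y \<in> ?F"
    then obtain a s b t where *: "x = Fract a s" "s \<notin> P" "y = Fract b t" "b \<in> I" "t \<notin> P"
      by blast
    thus "x * y \<in> ?F" using P(3)[OF *(2,5)] I(3)[OF *(4)] by auto
  qed blast
  have "extended_ideal P I \<subseteq> ?F"
    unfolding extended_ideal_def by (rule L.genideal_minimal[OF frac]) (use P in blast)
  hence 1: "\<exists>s. s \<notin> P \<and> s * f \<in> I" if "Fract f 1 \<in> extended_ideal P I" for f
  proof -
    have "Fract f 1 \<in> ?F"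
      using \<open>extended_ideal P I \<subseteq> ?F\<close> that by blast
    then obtain a s where as: "Fract f 1 = Fract a s" "a \<in> I" "s \<notin> P"
      by blast
    with P(1) have "s \<noteq> 0" by auto
    with as(1) have "s * f = a" by (simp add: eq_fract mult.commute)
    with as show ?thesis by blast
  qed
  have 2: "Fract f 1 \<in> extended_ideal P I" if "s \<notin> P" "s * f \<in> I" for s f
  proof -
    have "s \<noteq> 0" using that(1) P(1) by auto
    have "Fract (s * f) 1 \<in> extended_ideal P I"
      unfolding extended_ideal_def using L.genideal_self[OF gen] that(2) by blast
    moreover have "Fract 1 s \<in> ?H" using that(1) by blast
    ultimately have "Fract 1 s * Fract (s * f) 1 \<in> extended_ideal P I"
      using ext unfolding localization_def subring_ideal_iff[OF sub] by blast
    moreover have "Fract 1 s * Fract (s * f) 1 = Fract f 1"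
      using \<open>s \<noteq> 0\<close> by (simp add: eq_fract)
    ultimately show ?thesis by simp
  qed
  from 1 2 show ?thesis unfolding contracted_ideal_def by blast
qed

text \<open>Used to clear the components that become trivial in a localization from powers of the ideal.\<close>

lemma ideal_power_mult_power:
  fixes Q J :: "'a::comm_ring_1 set"
  assumes "\<And>q. q \<in> Q \<Longrightarrow> y * q \<in> J" "f \<in> ideal_power ring_of_type_algebra Q n"
  shows "y ^ n * f \<in> ideal_power ring_of_type_algebra J n"
  using assms(2)
proof (induction n arbitrary: f)
  case 0
  show ?case by (simp only: ideal_power_0 UNIV_I)
next
  case (Suc n)
  from Suc.prems show ?case
    unfolding ideal_power_Suc
  proof induction
    case (prod g q)
    have "(y ^ n * g) \<otimes>\<^bsub>ring_of_type_algebra\<^esub> (y * q) \<in>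
        ideal_prod ring_of_type_algebra (ideal_power ring_of_type_algebra J n) J"
      by (intro ideal_prod.prod Suc.IH assms(1) prod)
    thus ?case by (simp add: mult_ac)
  next
    case (sum g h)
    thus ?case
      using ideal_prod.sum[of "y ^ Suc n * g" ring_of_type_algebra _ J "y ^ Suc n * h"]
      by (simp add: distrib_left)
  qed
qed

section \<open>Symbolic powers of the dual ideal\<close>

text \<open>Distinct edges give incomparable pairs of variables. Consequently the components of the dual
  ideal have distinct radicals, all of which are minimal primes, and none of them is redundant.\<close>

locale oriented_edges =
  fixes ED :: "('v::{finite,linorder} \<times> 'v) set" and w :: "'v \<Rightarrow> nat"
  assumes weight_pos: "w i \<ge> 1"
    and loopless: "(i, j) \<in> ED \<Longrightarrow> i \<noteq> j"
    and edge_unique: "(i, j) \<in> ED \<Longrightarrow> (k, l) \<in> ED \<Longrightarrow> {k, l} \<subseteq> {i, j} \<Longrightarrow> (k, l) = (i, j)"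

text \<open>As every edge of the underlying graph is the image of an oriented edge, equality of the two
  cardinalities makes the map that forgets the direction injective.\<close>

lemma weighted_oriented_graph_imp_oriented_edges:
  assumes "weighted_oriented_graph EG ED w"
  shows "oriented_edges ED w"
proof -
  interpret weighted_oriented_graph EG ED w by fact
  have EG: "EG = (\<lambda>(i, j). {i, j}) ` ED"
    unfolding underlying by auto
  have inj: "inj_on (\<lambda>(i, j). {i, j}) ED"
    using one_direction unfolding EG by (intro eq_card_imp_inj_on) auto
  have ne: "i \<noteq> j" if "(i, j) \<in> ED" for i j
  proof -
    have "{i, j} \<in> EG" using that by (force simp: EG)
    from simple[OF this] show ?thesis by auto
  qed
  show ?thesis
  proof
    fix i j k l assume e: "(i, j) \<in> ED" "(k, l) \<in> ED" "{k, l} \<subseteq> {i, j}"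
    hence "{k, l} = {i, j}" using ne[OF e(2)] by auto
    thus "(k, l) = (i, j)" using inj_onD[OF inj _ e(2,1)] by simp
  qed (use weight_pos ne in auto)
qed

lemma order_ideal_edge_weights_1:
  assumes "i \<noteq> j" "m \<ge> 1"
  shows "order_ideal (edge_weights i j m) 1 =
    (span_monomials (edge_expos i j 1) :: ('v::{finite,linorder}, 'k::field) mpoly set)"
proof -
  have "1 \<le> weight (edge_weights i j m) a \<longleftrightarrow> a \<in> edge_expos i j 1" for a
    using assms(2) unfolding weight_edge_weights[OF assms(1)] edge_expos_def
    by (cases "lookup a i") auto
  thus ?thesis by (simp add: order_ideal_def)
qed

lemma primeideal_edge:
  assumes "i \<noteq> j"
  shows "primeideal (span_monomials (edge_expos i j 1) :: ('v::{finite,linorder}, 'k::field) mpoly set)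
     mpoly_ring"
  using primeideal_order_ideal_1[of "edge_weights i j 1", where 'k='k]
    order_ideal_edge_weights_1[OF assms, of 1, where 'k='k] by simp

context oriented_edges
begin

definition dual_expos :: "'v expo set" where
  "dual_expos = (\<Inter>(i, j)\<in>ED. edge_expos i j (w j))"

lemma upclosed_dual_expos: "upclosed dual_expos"
  using upclosed_edge_expos unfolding upclosed_iff dual_expos_def by fast

lemma dual_edge_ideal_eq:
  "(dual_edge_ideal ED w :: ('v, 'k::field) mpoly set) = span_monomials dual_expos"
  unfolding dual_edge_ideal_def edge_genideal dual_expos_def span_monomials_def by fast

lemma ideal_power_dual_edge_ideal:
  "ideal_power mpoly_ring (dual_edge_ideal ED w :: ('v, 'k::field) mpoly set) n =
     span_monomials (sumset_power dual_expos n)"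
  unfolding dual_edge_ideal_eq by (rule ideal_power_span_monomials[OF upclosed_dual_expos])

abbreviation component_power :: "'v \<times> 'v \<Rightarrow> nat \<Rightarrow> ('v, 'k::field) mpoly set" where
  "component_power e n \<equiv> order_ideal (edge_weights (fst e) (snd e) (w (snd e))) (n * w (snd e))"

lemma ideal_power_edge:
  assumes "(i, j) \<in> ED"
  shows "ideal_power mpoly_ring (span_monomials (edge_expos i j (w j)) :: ('v, 'k::field) mpoly set) n =
    component_power (i, j) n"
  using assms loopless[OF assms] weight_pos[of j]
  by (simp add: ideal_power_span_monomials[OF upclosed_edge_expos] sumset_power_edge_expos order_ideal_def)

lemma ideal_power_dual_subset:
  assumes "e \<in> ED"
  shows "ideal_power mpoly_ring (dual_edge_ideal ED w :: ('v, 'k::field) mpoly set) n \<subseteq> component_power e n"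
proof -
  obtain i j where e: "e = (i, j)" by force
  have "dual_expos \<subseteq> edge_expos i j (w j)"
    using assms by (auto simp: e dual_expos_def)
  hence "span_monomials (sumset_power dual_expos n) \<subseteq>
      (span_monomials (sumset_power (edge_expos i j (w j)) n) :: ('v, 'k) mpoly set)"
    using sumset_power_mono[of dual_expos _ n] unfolding span_monomials_def by blast
  thus ?thesis
    unfolding ideal_power_dual_edge_ideal e
      ideal_power_edge[OF assms[unfolded e], symmetric] ideal_power_span_monomials[OF upclosed_edge_expos] .
qed

text \<open>Otherwise each component \<open>(t\<^sub>i, t\<^sub>j\<^sup>w)\<close> contains an element outside \<open>P\<close>, and the product of these elements
  lies in the dual ideal.\<close>

lemma prime_contains_edge:
  fixes P :: "('v, 'k::field) mpoly set"
  assumes P: "primeideal P mpoly_ring" and sub: "dual_edge_ideal ED w \<subseteq> P"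
  obtains i j where "(i, j) \<in> ED" "span_monomials (edge_expos i j 1) \<subseteq> P"
proof -
  have "\<exists>e\<in>ED. (mpoly_var (fst e) :: ('v, 'k) mpoly) \<in> P \<and>
      (mpoly_var (snd e) :: ('v, 'k) mpoly) ^ w (snd e) \<in> P"
  proof (rule ccontr)
    assume *: "\<not> ?thesis"
    have "\<exists>x. x \<in> span_monomials (edge_expos (fst e) (snd e) (w (snd e))) \<and> x \<notin> P" if "e \<in> ED" for e
    proof (cases "(mpoly_var (fst e) :: ('v, 'k) mpoly) \<in> P")
      case False
      thus ?thesis by (intro exI[of _ "mpoly_var (fst e)"]) (auto simp: mpoly_var_def edge_expos_def)
    next
      case True
      with * that have "(mpoly_var (snd e) :: ('v, 'k) mpoly) ^ w (snd e) \<notin> P" by blast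
      thus ?thesis
        by (intro exI[of _ "mpoly_var (snd e) ^ w (snd e)"]) (auto simp: mpoly_var_power edge_expos_def)
    qed
    then obtain x where x: "\<And>e. e \<in> ED \<Longrightarrow> x e \<in> span_monomials (edge_expos (fst e) (snd e) (w (snd e)))"
      "\<And>e. e \<in> ED \<Longrightarrow> x e \<notin> P"
      by metis
    have "prod x ED \<in> span_monomials (edge_expos (fst e) (snd e) (w (snd e)))" if "e \<in> ED" for e
    proof -
      have "prod x ED = prod x (ED - {e}) * x e"
        using that by (simp add: prod.remove[of ED e] mult.commute)
      thus ?thesis
        using span_monomials_absorb[OF upclosed_edge_expos x(1)[OF that]] by simp
    qed
    hence "prod x ED \<in> dual_edge_ideal ED w"
      unfolding dual_edge_ideal_def edge_genideal by fastforce
    with sub obtain e where "e \<in> ED" "x e \<in> P"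
      using primeideal_prod[OF P, of ED x] by auto
    with x show False by blast
  qed
  then obtain i j where ij: "(i, j) \<in> ED" "mpoly_var i \<in> P" "mpoly_var j ^ w j \<in> P" by force
  hence "mpoly_var j \<in> P" using primeideal_power[OF P] by blast
  hence "Idl\<^bsub>mpoly_ring\<^esub> {mpoly_var i, mpoly_var j ^ 1} \<subseteq> P"
    using P ij by (intro ring.genideal_minimal) (auto simp: type_ring_primeideal_iff)
  with ij(1) that show ?thesis unfolding edge_genideal by blast
qed

lemma dual_edge_ideal_subset_prime:
  assumes "(i, j) \<in> ED"
  shows "dual_edge_ideal ED w \<subseteq> (span_monomials (edge_expos i j 1) :: ('v, 'k::field) mpoly set)"
proof -
  have "edge_expos i j (w j) \<subseteq> edge_expos i j 1"
    using weight_pos[of j] by (auto simp: edge_expos_def)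
  thus ?thesis
    using assms unfolding dual_edge_ideal_def edge_genideal span_monomials_def by blast
qed

lemma minimal_primes_dual_edge_ideal:
  "minimal_primes mpoly_ring (dual_edge_ideal ED w :: ('v, 'k::field) mpoly set) =
     (\<lambda>(i, j). span_monomials (edge_expos i j 1)) ` ED" (is "?L = ?R")
proof (intro equalityI subsetI)
  fix P assume "P \<in> ?R"
  then obtain i j where ij: "(i, j) \<in> ED" "P = span_monomials (edge_expos i j 1)" by auto
  have "Q = P" if Q: "primeideal Q mpoly_ring" "dual_edge_ideal ED w \<subseteq> Q" "Q \<subseteq> P" for Q
  proof -
    obtain k l where kl: "(k, l) \<in> ED" "span_monomials (edge_expos k l 1) \<subseteq> Q"
      by (rule prime_contains_edge[OF Q(1,2)])
    have "(monomial (Poly_Mapping.single k 1) :: ('v, 'k) mpoly) \<in> span_monomials (edge_expos k l 1)"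
      "(monomial (Poly_Mapping.single l 1) :: ('v, 'k) mpoly) \<in> span_monomials (edge_expos k l 1)"
      by (simp_all add: edge_expos_def)
    with kl(2) Q(3) have "(monomial (Poly_Mapping.single k 1) :: ('v, 'k) mpoly) \<in> P"
      "(monomial (Poly_Mapping.single l 1) :: ('v, 'k) mpoly) \<in> P" by blast+
    hence "{k, l} \<subseteq> {i, j}"
      by (auto simp: ij(2) edge_expos_def lookup_single when_def split: if_splits)
    hence "(k, l) = (i, j)" by (rule edge_unique[OF ij(1) kl(1)])
    with kl Q(3) ij(2) show ?thesis by auto
  qed
  thus "P \<in> ?L"
    unfolding minimal_primes_def
    using primeideal_edge[OF loopless[OF ij(1)], where 'k='k]
      dual_edge_ideal_subset_prime[OF ij(1), where 'k='k] ij(2) by blast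
next
  fix P assume "P \<in> ?L"
  hence P: "primeideal P mpoly_ring" "dual_edge_ideal ED w \<subseteq> P"
    "\<And>Q. primeideal Q mpoly_ring \<Longrightarrow> dual_edge_ideal ED w \<subseteq> Q \<Longrightarrow> Q \<subseteq> P \<Longrightarrow> Q = P"
    unfolding minimal_primes_def by auto
  obtain k l where kl: "(k, l) \<in> ED" "span_monomials (edge_expos k l 1) \<subseteq> P"
    by (rule prime_contains_edge[OF P(1,2)])
  have "span_monomials (edge_expos k l 1) = P"
    by (rule P(3)) (use kl(2) primeideal_edge[OF loopless[OF kl(1)]]
        dual_edge_ideal_subset_prime[OF kl(1)] in blast)+
  with kl(1) show "P \<in> ?R" by force
qed

text \<open>An element outside \<open>(t\<^sub>i, t\<^sub>j)\<close> has order 0, which makes the powers of \<open>(t\<^sub>i, t\<^sub>j\<^sup>w)\<close> primary;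
  the other components of the dual ideal become trivial in the localization, since each of
  them contains a power of a variable different from \<open>t\<^sub>i\<close> and \<open>t\<^sub>j\<close>.\<close>

lemma contracted_dual_power:
  assumes e: "(i, j) \<in> ED"
  shows "contracted_ideal (extended_ideal (span_monomials (edge_expos i j 1))
           (ideal_power mpoly_ring (dual_edge_ideal ED w :: ('v, 'k::field) mpoly set) n)) =
         component_power (i, j) n" (is "contracted_ideal (extended_ideal ?P ?Jn) = ?Q")
proof -
  have P: "primeideal ?P mpoly_ring" by (rule primeideal_edge[OF loopless[OF e]])
  have Jn: "ideal ?Jn mpoly_ring"
    unfolding ideal_power_dual_edge_ideal
    by (intro ideal_span_monomials upclosed_sumset_power upclosed_dual_expos)
  have 1: "f \<in> ?Q" if "s \<notin> ?P" "s * f \<in> ?Jn" for s f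
  proof -
    have sf: "s * f \<in> ?Q" using ideal_power_dual_subset[OF e] that(2) by blast
    have "s \<notin> order_ideal (edge_weights i j (w j)) 1"
      using that(1) order_ideal_edge_weights_1[OF loopless[OF e] weight_pos] by blast
    with sf show ?thesis
      by (cases "f = 0") (auto simp: mem_order_ideal_iff weighted_order_mult)
  qed
  have 2: "\<exists>s. s \<notin> ?P \<and> s * f \<in> ?Jn" if f: "f \<in> ?Q" for f
  proof -
    let ?x = "\<lambda>(k, l). (if k \<notin> {i, j} then mpoly_var k else mpoly_var l ^ w l) :: ('v, 'k) mpoly"
    let ?y = "prod ?x (ED - {(i, j)})"
    have x_notin: "?x (k, l) \<notin> ?P" if "(k, l) \<in> ED - {(i, j)}" for k l
    proof (cases "k \<in> {i, j}")
      case True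
      have "\<not> {k, l} \<subseteq> {i, j}" using edge_unique[OF e, of k l] that by blast
      with True have "l \<noteq> i" "l \<noteq> j" by blast+
      with True show ?thesis by (auto simp: mpoly_var_power edge_expos_def lookup_single)
    qed (simp add: mpoly_var_def edge_expos_def lookup_single)
    have x_in: "?x (k, l) \<in> span_monomials (edge_expos k l (w l))" for k l
      unfolding mpoly_var_power by (auto simp: mpoly_var_def edge_expos_def)
    have "?y \<notin> ?P"
    proof
      assume "?y \<in> ?P"
      then obtain e' where "e' \<in> ED - {(i, j)}" "?x e' \<in> ?P"
        using primeideal_prod[OF P, of "ED - {(i, j)}" ?x] by auto
      with x_notin show False by (cases e') blast
    qed
    hence y: "?y ^ n \<notin> ?P" using primeideal_power[OF P] by blast
    have "?y * q \<in> dual_edge_ideal ED w" if q: "q \<in> span_monomials (edge_expos i j (w j))" for q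
      unfolding dual_edge_ideal_def edge_genideal
    proof clarify
      fix k l assume kl: "(k, l) \<in> ED"
      note absorb = span_monomials_absorb[OF upclosed_edge_expos]
      show "?y * q \<in> span_monomials (edge_expos k l (w l))"
      proof (cases "(k, l) = (i, j)")
        case True
        thus ?thesis using absorb[OF q] by simp
      next
        case False
        hence "?y = prod ?x (ED - {(i, j)} - {(k, l)}) * ?x (k, l)"
          using kl by (subst prod.remove[of _ "(k, l)"]) (auto simp: mult.commute)
        hence "?y * q = (prod ?x (ED - {(i, j)} - {(k, l)}) * q) * ?x (k, l)"
          by (simp only: mult_ac)
        thus ?thesis using absorb[OF x_in[of k l]] by (simp only:)
      qed
    qed
    moreover have "f \<in> ideal_power mpoly_ring (span_monomials (edge_expos i j (w j))) n"
      unfolding ideal_power_edge[OF e] by (rule f)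
    ultimately have "?y ^ n * f \<in> ?Jn"
      by (rule ideal_power_mult_power)
    with y show ?thesis by blast
  qed
  show ?thesis
    unfolding contracted_extended_ideal[OF P Jn] using 1 2 by blast
qed

lemma symbolic_power_dual_edge_ideal:
  "symbolic_power (dual_edge_ideal ED w :: ('v, 'k::field) mpoly set) n = (\<Inter>e\<in>ED. component_power e n)"
  unfolding symbolic_power_def minimal_primes_dual_edge_ideal
  using contracted_dual_power by force

text \<open>The symbolic power is an intersection of ideals defined by valuations, and such ideals are
  integrally closed.\<close>

lemma integral_closure_subset_symbolic_power:
  "integral_closure mpoly_ring (ideal_power mpoly_ring (dual_edge_ideal ED w :: ('v, 'k::field) mpoly set) n)
     \<subseteq> symbolic_power (dual_edge_ideal ED w) n"
  unfolding symbolic_power_dual_edge_ideal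
proof (intro INT_greatest integral_closure_subset_order_ideal)
  fix e i assume e: "e \<in> ED"
  have "ideal_power mpoly_ring (ideal_power mpoly_ring (dual_edge_ideal ED w :: ('v, 'k) mpoly set) n) i =
      ideal_power mpoly_ring (dual_edge_ideal ED w) (n * i)"
    unfolding ideal_power_dual_edge_ideal
    by (simp only: ideal_power_span_monomials[OF upclosed_sumset_power[OF upclosed_dual_expos]]
        sumset_power_mult[OF upclosed_dual_expos])
  also have "\<dots> \<subseteq> component_power e (n * i)" by (rule ideal_power_dual_subset[OF e])
  finally show "ideal_power mpoly_ring (ideal_power mpoly_ring (dual_edge_ideal ED w :: ('v, 'k) mpoly set) n) i
     \<subseteq> order_ideal (edge_weights (fst e) (snd e) (w (snd e))) (i * (n * w (snd e)))"
    by (simp add: mult_ac)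
qed

end

section \<open>Dickson's lemma\<close>

lemma nat_seq_mono_subseq:
  fixes f :: "nat \<Rightarrow> nat"
  obtains r :: "nat \<Rightarrow> nat" where "strict_mono r" "mono (f \<circ> r)"
proof -
  obtain g where g: "strict_mono g" "monoseq (f \<circ> g)"
    using seq_monosub[of f] by (auto simp: comp_def)
  show ?thesis
  proof (cases "mono (f \<circ> g)")
    case True
    show ?thesis by (rule that[OF g(1) True])
  next
    case False
    with g(2) have dec: "\<And>m n. m \<le> n \<Longrightarrow> f (g n) \<le> f (g m)"
      unfolding monoseq_def mono_def comp_def by blast
    obtain N where N: "\<And>n. f (g N) \<le> f (g n)"
      using ex_has_least_nat[of "\<lambda>_. True" _ "\<lambda>n. f (g n)"] by auto
    have "f (g (n + N)) = f (g N)" for n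
      using N[of "n + N"] dec[of N "n + N"] by simp
    hence "mono (f \<circ> (\<lambda>n. g (n + N)))" by (simp add: mono_def)
    have "strict_mono (\<lambda>n. g (n + N))"
      using g(1) by (auto simp: strict_mono_def)
    from this \<open>mono _\<close> show ?thesis by (rule that)
  qed
qed

text \<open>A subsequence that increases in all coordinates is found by passing to subsequences once for
  each coordinate.\<close>

lemma dickson:
  fixes f :: "'i::finite \<Rightarrow> nat \<Rightarrow> nat"
  obtains m n where "m < n" "\<And>i. f i m \<le> f i n"
proof -
  have "\<exists>r :: nat \<Rightarrow> nat. strict_mono r \<and> (\<forall>i\<in>A. mono (f i \<circ> r))" if "finite A" for A :: "'i set"
    using that
  proof (induction A)
    case empty
    show ?case by (intro exI[of _ id]) (auto simp: strict_mono_def)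
  next
    case (insert i A)
    then obtain r :: "nat \<Rightarrow> nat" where r: "strict_mono r" "\<forall>i\<in>A. mono (f i \<circ> r)" by blast
    obtain s :: "nat \<Rightarrow> nat" where s: "strict_mono s" "mono ((f i \<circ> r) \<circ> s)"
      by (rule nat_seq_mono_subseq)
    have "mono (f k \<circ> (r \<circ> s))" if "k \<in> A" for k
      using r(2) that strict_mono_mono[OF s(1)] by (auto simp: mono_def)
    moreover have "strict_mono (r \<circ> s)" using r(1) s(1) by (auto simp: strict_mono_def)
    ultimately show ?case using s(2) unfolding comp_assoc
      by (intro exI[of _ "r \<circ> s"]) blast
  qed
  from this[of UNIV] obtain r :: "nat \<Rightarrow> nat" where r: "strict_mono r" "\<And>i. mono (f i \<circ> r)" by auto
  have "r 0 < r 1" using r(1) by (simp add: strict_mono_def)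
  moreover have "f i (r 0) \<le> f i (r 1)" for i using r(2)[of i] by (auto simp: mono_def)
  ultimately show ?thesis by (rule that)
qed

section \<open>Minimal generators and the Newton polyhedron\<close>

definition minimal_expos :: "'v expo set \<Rightarrow> 'v expo set" where
  "minimal_expos M = {a\<in>M. \<forall>b\<in>M. (\<forall>i. lookup b i \<le> lookup a i) \<longrightarrow> b = a}"

lemma finite_minimal_expos: "finite (minimal_expos (M :: 'v::finite expo set))"
proof (rule ccontr)
  assume "infinite (minimal_expos M)"
  then obtain u :: "nat \<Rightarrow> 'v expo" where u: "inj u" "range u \<subseteq> minimal_expos M"
    using infinite_countable_subset by blast
  obtain m n where mn: "m < n" "\<And>i. lookup (u m) i \<le> lookup (u n) i"
    using dickson[of "\<lambda>i m. lookup (u m) i"] by blast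
  have "u m \<in> M" "u n \<in> minimal_expos M" using u(2) by (auto simp: minimal_expos_def)
  with mn(2) have "u m = u n" unfolding minimal_expos_def by blast
  with u(1) mn(1) show False by (auto dest: injD)
qed

lemma minimal_expos_generate:
  fixes M :: "'v::finite expo set"
  assumes "upclosed M"
  shows "minimal_expos M + UNIV = M"
proof
  show "minimal_expos M + UNIV \<subseteq> M"
    using upclosed_add[OF assms] by (auto simp: set_plus_def minimal_expos_def)
  show "M \<subseteq> minimal_expos M + UNIV"
  proof
    fix a assume "a \<in> M"
    then obtain b where b: "b \<in> M" "\<forall>i. lookup b i \<le> lookup a i"
      "\<And>c. c \<in> M \<Longrightarrow> \<forall>i. lookup c i \<le> lookup a i \<Longrightarrow> (\<Sum>i\<in>UNIV. lookup b i) \<le> (\<Sum>i\<in>UNIV. lookup c i)"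
      using ex_has_least_nat[of "\<lambda>b. b \<in> M \<and> (\<forall>i. lookup b i \<le> lookup a i)" a "\<lambda>b. \<Sum>i\<in>UNIV. lookup b i"]
      by auto
    have "b \<in> minimal_expos M"
      unfolding minimal_expos_def
    proof (intro CollectI conjI ballI impI b(1))
      fix c assume c: "c \<in> M" "\<forall>i. lookup c i \<le> lookup b i"
      hence "(\<Sum>i\<in>UNIV. lookup b i) \<le> (\<Sum>i\<in>UNIV. lookup c i)"
        using b by (meson order_trans)
      hence "(\<Sum>i\<in>UNIV. lookup c i) = (\<Sum>i\<in>UNIV. lookup b i)"
        using c(2) by (intro antisym[OF sum_mono]) auto
      hence "lookup c i = lookup b i" for i
        using sum_mono_inv[of "lookup c" UNIV "lookup b"] c(2) by auto
      thus "c = b" by (intro poly_mapping_eqI)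
    qed
    with b(2) show "a \<in> minimal_expos M + UNIV"
      by (auto simp: mem_plus_UNIV_iff)
  qed
qed

text \<open>Every set of exponents generating \<open>M\<close> contains the minimal elements of \<open>M\<close>, which themselves generate,
  so they form the unique inclusion-minimal generating set.\<close>

lemma minimal_monomial_generators_span:
  assumes "upclosed M"
  shows "minimal_monomial_generators (span_monomials M :: ('v::{finite,linorder}, 'k::field) mpoly set) =
         minimal_expos M"
  unfolding minimal_monomial_generators_def genideal_monomials span_monomials_eq_iff
proof (rule the_equality)
  have least: "minimal_expos M \<subseteq> A" if "A + UNIV = M" for A
  proof
    fix a assume a: "a \<in> minimal_expos M"
    hence "a \<in> A + UNIV" by (simp add: that minimal_expos_def)
    then obtain b where b: "b \<in> A" "\<forall>i. lookup b i \<le> lookup a i"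
      by (auto simp: mem_plus_UNIV_iff)
    moreover have "b \<in> M" using b(1) subset_plus_UNIV[of A] that by blast
    ultimately show "a \<in> A" using a by (auto simp: minimal_expos_def)
  qed
  show "minimal_expos M + UNIV = M \<and> (\<forall>B\<subset>minimal_expos M. B + UNIV \<noteq> M)"
    using minimal_expos_generate[OF assms] least by blast
  show "A = minimal_expos M" if "A + UNIV = M \<and> (\<forall>B\<subset>A. B + UNIV \<noteq> M)" for A
    using minimal_expos_generate[OF assms] least that by blast
qed

lemma expo_vec_nth [simp]: "expo_vec a $ i = real (lookup a i)"
  by (simp add: expo_vec_def)

lemma expo_vec_add: "expo_vec (a + b) = expo_vec a + expo_vec b"
  by (simp add: vec_eq_iff lookup_add)

lemma inj_expo_vec: "inj expo_vec"
  by (auto intro!: injI poly_mapping_eqI simp: vec_eq_iff)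

lemma newton_polyhedron_eq:
  assumes "upclosed M"
  shows "newton_polyhedron (span_monomials M :: ('v::{finite,linorder}, 'k::field) mpoly set) =
         {x. 0 \<le> x} + convex hull (expo_vec ` minimal_expos M)"
  unfolding newton_polyhedron_def minimal_monomial_generators_span[OF assms] set_plus_def by blast

lemma convex_nonneg_vec: "convex {x :: real ^ 'v::finite. 0 \<le> x}"
  by (auto simp: convex_def less_eq_vec_def)

lemma closed_nonneg_vec: "closed {x :: real ^ 'v::finite. 0 \<le> x}"
proof -
  have "{x :: real ^ 'v::finite. 0 \<le> x} = (\<Inter>i. {x. 0 \<le> x $ i})"
    by (auto simp: less_eq_vec_def)
  thus ?thesis by (auto intro!: closed_INT closed_Collect_le continuous_intros)
qed

lemma convex_newton_polyhedron:
  assumes "upclosed M"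
  shows "convex (newton_polyhedron (span_monomials M :: ('v::{finite,linorder}, 'k::field) mpoly set))"
  unfolding newton_polyhedron_eq[OF assms]
  by (intro convex_set_plus convex_nonneg_vec convex_convex_hull)

text \<open>Finiteness of the set of generators enters here: the convex hull is compact, and the sum of a closed
  and a compact set is closed.\<close>

lemma closed_newton_polyhedron:
  assumes "upclosed M"
  shows "closed (newton_polyhedron (span_monomials M :: ('v::{finite,linorder}, 'k::field) mpoly set))"
proof -
  have "compact (convex hull (expo_vec ` minimal_expos M))"
    by (intro finite_imp_compact_convex_hull finite_imageI finite_minimal_expos)
  from closed_compact_sums[OF closed_nonneg_vec this]
  have "closed (\<Union>x\<in>{x. 0 \<le> x}. \<Union>y\<in>convex hull (expo_vec ` minimal_expos M). {x + y})" .
  moreover have "(\<Union>x\<in>{x. 0 \<le> x}. \<Union>y\<in>convex hull (expo_vec ` minimal_expos M). {x + y}) =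
      {x. 0 \<le> x} + convex hull (expo_vec ` minimal_expos M)"
    by (auto simp: set_plus_def)
  ultimately show ?thesis unfolding newton_polyhedron_eq[OF assms] by simp
qed

lemma expo_vec_in_newton_polyhedron:
  assumes "upclosed M" "a \<in> M"
  shows "expo_vec a \<in> newton_polyhedron (span_monomials M :: ('v::{finite,linorder}, 'k::field) mpoly set)"
proof -
  have "a \<in> minimal_expos M + UNIV" using minimal_expos_generate[OF assms(1)] assms(2) by simp
  then obtain b c where bc: "b \<in> minimal_expos M" "a = c + b"
    by (auto simp: set_plus_def add.commute)
  have "expo_vec c \<in> {x. 0 \<le> x}" by (simp add: less_eq_vec_def)
  moreover have "expo_vec b \<in> convex hull (expo_vec ` minimal_expos M)"
    using bc(1) by (simp add: hull_inc)
  ultimately show ?thesis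
    unfolding newton_polyhedron_eq[OF assms(1)] bc(2) expo_vec_add by (rule set_plus_intro)
qed

text \<open>The quotient by \<open>n\<close> is an average of \<open>n\<close> points of the Newton polyhedron.\<close>

lemma sumset_power_newton_polyhedron:
  assumes "upclosed M" "n \<ge> 1" "a \<in> sumset_power M n"
  shows "expo_vec a /\<^sub>R real n \<in>
    newton_polyhedron (span_monomials M :: ('v::{finite,linorder}, 'k::field) mpoly set)" (is "_ \<in> ?N")
  using assms(2,3)
proof (induction n arbitrary: a rule: nat_induct_at_least)
  case base
  thus ?case using sumset_power_1[OF assms(1)] expo_vec_in_newton_polyhedron[OF assms(1)] by simp
next
  case (Suc n)
  from Suc.prems obtain b c where bc: "a = b + c" "b \<in> sumset_power M n" "c \<in> M"
    by (auto simp: set_plus_def)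
  have "(real n / real (Suc n)) *\<^sub>R (expo_vec b /\<^sub>R real n) + (1 / real (Suc n)) *\<^sub>R expo_vec c \<in> ?N"
    by (rule convexD[OF convex_newton_polyhedron[OF assms(1)] Suc.IH[OF bc(2)]
          expo_vec_in_newton_polyhedron[OF assms(1) bc(3)]])
       (simp_all add: field_simps)
  moreover have "(real n / real (Suc n)) *\<^sub>R (expo_vec b /\<^sub>R real n) + (1 / real (Suc n)) *\<^sub>R expo_vec c =
      expo_vec a /\<^sub>R real (Suc n)"
    using Suc.hyps by (simp add: bc(1) expo_vec_add vec_eq_iff field_simps)
  ultimately show ?case by simp
qed

lemma lookup_multiple [simp]: "lookup (\<Sum>_<(k::nat). a) i = k * (lookup a i :: nat)"
  by (simp add: lookup_sum)

lemma sumset_power_antimono: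
  assumes "upclosed M" "k \<le> l"
  shows "sumset_power M l \<subseteq> sumset_power M k"
proof -
  have "sumset_power M l = sumset_power M k + sumset_power M (l - k)"
    using assms(2) by (simp flip: sumset_power_add[OF assms(1)])
  thus ?thesis
    using upclosed_add[OF upclosed_sumset_power[OF assms(1)]] by (auto simp: set_plus_def)
qed

lemma multiple_in_sumset_power: "v \<in> M \<Longrightarrow> (\<Sum>_<k. v) \<in> sumset_power M k"
  by (induction k) (auto intro: set_plus_intro)

lemma combination_in_sumset_power:
  assumes "upclosed M" "finite V" "V \<subseteq> M"
  shows "(\<Sum>v\<in>V. \<Sum>_<(e v :: nat). v) \<in> sumset_power M (\<Sum>v\<in>V. e v)"
  using assms(2,3)
proof (induction V)
  case (insert v V)
  thus ?case
    by (simp add: sumset_power_add[OF assms(1)] set_plus_intro multiple_in_sumset_power)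
qed simp

text \<open>Here a real combination is turned into an integral one. Multiplying by \<open>m\<close> and rounding the
  coefficients down gives \<open>m a = u\<^sub>m + (\<Sum>v. d\<^sub>m\<^sub>v v)\<close> with remainders \<open>u\<^sub>m \<ge> 0\<close>, and the sum of the
  \<open>d\<^sub>m\<^sub>v\<close> falls short of \<open>m n\<close> by at most the number of vectors. Dickson's lemma provides \<open>m < m'\<close> with
  \<open>u\<^sub>m \<le> u\<^sub>m\<^sub>'\<close> and a shortfall for \<open>m'\<close> not exceeding that for \<open>m\<close>. Subtracting the two decompositions
  writes \<open>(m' - m) a\<close> as a sum of at least \<open>(m' - m) n\<close> elements of \<open>M\<close> and a nonnegative
  remainder.\<close>

lemma real_combination_imp_multiple:
  fixes a :: "'v::finite expo" and c :: "'v expo \<Rightarrow> real"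
  assumes M: "upclosed M" and V: "finite V" "V \<subseteq> M"
    and c: "\<And>v. v \<in> V \<Longrightarrow> c v \<ge> 0" "(\<Sum>v\<in>V. c v) = real n"
    and le: "\<And>i. (\<Sum>v\<in>V. c v * real (lookup v i)) \<le> real (lookup a i)"
  obtains N where "N \<ge> 1" "(\<Sum>_<N. a) \<in> sumset_power M (n * N)"
proof -
  define d where "d m v = nat \<lfloor>real m * c v\<rfloor>" for m :: nat and v
  define u where "u m i = m * lookup a i - (\<Sum>v\<in>V. d m v * lookup v i)" for m i
  \<comment> \<open>The shortfall is subtracted from its bound \<open>card V\<close>, since Dickson's lemma makes sequences increase.\<close>
  define r where "r m = card V + (\<Sum>v\<in>V. d m v) - m * n" for m
  have d: "real (d m v) \<le> real m * c v" "real m * c v \<le> real (d m v) + 1" if "v \<in> V" for m v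
    using c(1)[OF that] by (auto simp: d_def of_nat_nat mult_nonneg_nonneg)
  have d_mono: "d m v \<le> d m' v" if "m \<le> m'" "v \<in> V" for m m' v
    using that c(1)[of v] unfolding d_def by (intro nat_mono floor_mono mult_right_mono) auto
  have u: "u m i + (\<Sum>v\<in>V. d m v * lookup v i) = m * lookup a i" for m i
  proof -
    have "(\<Sum>v\<in>V. real (d m v) * real (lookup v i)) \<le> (\<Sum>v\<in>V. real m * c v * real (lookup v i))"
      by (intro sum_mono mult_right_mono d) auto
    also have "\<dots> = real m * (\<Sum>v\<in>V. c v * real (lookup v i))"
      by (simp add: sum_distrib_left mult.assoc)
    also have "\<dots> \<le> real m * real (lookup a i)"
      by (intro mult_left_mono le) auto
    finally have "real (\<Sum>v\<in>V. d m v * lookup v i) \<le> real (m * lookup a i)" by simp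
    hence "(\<Sum>v\<in>V. d m v * lookup v i) \<le> m * lookup a i" by (simp only: of_nat_le_iff)
    thus ?thesis by (simp add: u_def)
  qed
  have r: "r m + m * n = card V + (\<Sum>v\<in>V. d m v)" for m
  proof -
    have "real m * real n = (\<Sum>v\<in>V. real m * c v)"
      by (simp add: c(2)[symmetric] sum_distrib_left)
    also have "\<dots> \<le> (\<Sum>v\<in>V. real (d m v) + 1)"
      by (intro sum_mono d)
    finally have "real (m * n) \<le> real (card V + (\<Sum>v\<in>V. d m v))"
      by (simp add: sum.distrib)
    hence "m * n \<le> card V + (\<Sum>v\<in>V. d m v)" by (simp only: of_nat_le_iff)
    thus ?thesis by (simp add: r_def)
  qed
  obtain m m' where m: "m < m'"
    and mono: "\<And>k. (case k of None \<Rightarrow> r m | Some i \<Rightarrow> u m i) \<le> (case k of None \<Rightarrow> r m' | Some i \<Rightarrow> u m' i)"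
    using dickson[of "\<lambda>k m. case k of None \<Rightarrow> r m | Some i \<Rightarrow> u m i"] by blast
  have rm: "r m \<le> r m'" and um: "\<And>i. u m i \<le> u m' i"
    using mono[of None] mono[of "Some _"] by simp_all
  define e where "e v = d m' v - d m v" for v
  have e: "d m v + e v = d m' v" if "v \<in> V" for v
    using d_mono[of m m' v] m that by (simp add: e_def)
  have "n * (m' - m) \<le> (\<Sum>v\<in>V. e v)"
  proof -
    have "(\<Sum>v\<in>V. d m v) + (\<Sum>v\<in>V. e v) = (\<Sum>v\<in>V. d m' v)"
      unfolding sum.distrib[symmetric] by (rule sum.cong) (auto simp: e)
    with r[of m] r[of m'] rm have "m' * n \<le> m * n + (\<Sum>v\<in>V. e v)" by linarith
    thus ?thesis by (simp add: diff_mult_distrib2 mult.commute[of n])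
  qed
  hence comb: "(\<Sum>v\<in>V. \<Sum>_<e v. v) \<in> sumset_power M (n * (m' - m))"
    using combination_in_sumset_power[OF M V, of e] sumset_power_antimono[OF M] by blast
  have "lookup (\<Sum>v\<in>V. \<Sum>_<e v. v) i \<le> lookup (\<Sum>_<m' - m. a) i" for i
  proof -
    have "(\<Sum>v\<in>V. d m v * lookup v i) + (\<Sum>v\<in>V. e v * lookup v i) = (\<Sum>v\<in>V. d m' v * lookup v i)"
      unfolding sum.distrib[symmetric] by (rule sum.cong) (auto simp: e[symmetric] add_mult_distrib)
    with u[of m i] u[of m' i] um[of i]
    have "m * lookup a i + (\<Sum>v\<in>V. e v * lookup v i) \<le> m' * lookup a i" by linarith
    thus ?thesis by (simp add: lookup_sum[of _ V] diff_mult_distrib)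
  qed
  hence "(\<Sum>_<m' - m. a) \<in> sumset_power M (n * (m' - m)) + UNIV"
    using comb unfolding mem_plus_UNIV_iff by blast
  hence "(\<Sum>_<m' - m. a) \<in> sumset_power M (n * (m' - m))"
    using upclosed_sumset_power[OF M] by (simp add: upclosed_def)
  with m that[of "m' - m"] show ?thesis by simp
qed

lemma newton_polyhedron_imp_multiple:
  fixes a :: "'v::{finite,linorder} expo"
  assumes M: "upclosed M" and n: "n \<ge> 1"
    and a: "expo_vec a /\<^sub>R real n \<in> newton_polyhedron (span_monomials M :: ('v, 'k::field) mpoly set)"
  obtains N where "N \<ge> 1" "(\<Sum>_<N. a) \<in> sumset_power M (n * N)"
proof -
  let ?V = "minimal_expos M"
  from a obtain x y where xy: "expo_vec a /\<^sub>R real n = x + y" "0 \<le> x" "y \<in> convex hull (expo_vec ` ?V)"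
    unfolding newton_polyhedron_eq[OF M] by (auto simp: set_plus_def)
  from xy(3) obtain l where l: "\<And>z. z \<in> expo_vec ` ?V \<Longrightarrow> 0 \<le> l z" "sum l (expo_vec ` ?V) = 1"
    "(\<Sum>z\<in>expo_vec ` ?V. l z *\<^sub>R z) = y"
    unfolding convex_hull_finite[OF finite_imageI[OF finite_minimal_expos]] by blast
  have inj: "inj_on expo_vec ?V" using inj_expo_vec by (rule inj_on_subset) simp
  define c where "c v = real n * l (expo_vec v)" for v
  show ?thesis
  proof (rule real_combination_imp_multiple[OF M finite_minimal_expos])
    show "?V \<subseteq> M" by (auto simp: minimal_expos_def)
    show "c v \<ge> 0" if "v \<in> ?V" for v using l(1) that by (simp add: c_def)
    show "(\<Sum>v\<in>?V. c v) = real n"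
      using l(2) by (simp add: c_def sum.reindex[OF inj] flip: sum_distrib_left)
    fix i
    have "(\<Sum>v\<in>?V. c v * real (lookup v i)) = real n * (\<Sum>v\<in>?V. l (expo_vec v) * real (lookup v i))"
      by (simp add: c_def sum_distrib_left mult.assoc)
    also have "(\<Sum>v\<in>?V. l (expo_vec v) * real (lookup v i)) = y $ i"
      unfolding l(3)[symmetric] sum.reindex[OF inj] by simp
    also have "y $ i \<le> (expo_vec a /\<^sub>R real n) $ i"
      using xy(2) unfolding xy(1) by (simp add: less_eq_vec_def)
    also have "real n * \<dots> = real (lookup a i)" using n by simp
    finally show "(\<Sum>v\<in>?V. c v * real (lookup v i)) \<le> real (lookup a i)"
      by (simp add: mult_left_mono)
  qed (use that in blast)
qed

section \<open>Irreducible decompositions\<close>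

definition irreducible_expos :: "'v expo \<Rightarrow> 'v expo set" where
  "irreducible_expos b = {a. \<exists>i. 1 \<le> lookup b i \<and> lookup b i \<le> lookup a i}"

lemma irreducible_ideal_eq:
  "irreducible_ideal b = (span_monomials (irreducible_expos b) :: ('v::{finite,linorder}, 'k::field) mpoly set)"
proof -
  let ?A = "{Poly_Mapping.single i (lookup b i) | i. 1 \<le> lookup b i}"
  have "{mpoly_var i ^ lookup b i | i. 1 \<le> lookup b i} = (monomial ` ?A :: ('v, 'k) mpoly set)"
    unfolding mpoly_var_power by blast
  moreover have "?A + UNIV = irreducible_expos b"
    by (rule Set.set_eqI, unfold mem_plus_UNIV_iff)
       (auto simp: irreducible_expos_def lookup_single when_def split: if_splits)
  ultimately show ?thesis unfolding irreducible_ideal_def by (simp only: genideal_monomials)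
qed

lemma irreducible_expos_subset_iff:
  "irreducible_expos b \<subseteq> irreducible_expos c \<longleftrightarrow>
     (\<forall>i. 1 \<le> lookup b i \<longrightarrow> 1 \<le> lookup c i \<and> lookup c i \<le> lookup (b :: 'v expo) i)" (is "?L \<longleftrightarrow> ?R")
proof
  assume L: ?L
  show ?R
  proof (intro allI impI)
    fix i assume i: "1 \<le> lookup b i"
    hence "Poly_Mapping.single i (lookup b i) \<in> irreducible_expos b"
      by (auto simp: irreducible_expos_def intro!: exI[of _ i])
    with L have "Poly_Mapping.single i (lookup b i) \<in> irreducible_expos c" by blast
    thus "1 \<le> lookup c i \<and> lookup c i \<le> lookup b i"
      by (auto simp: irreducible_expos_def lookup_single when_def split: if_splits)
  qed
next
  assume ?R
  thus ?L unfolding irreducible_expos_def using order_trans by blast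
qed

lemma irreducible_expos_inj:
  assumes "irreducible_expos b = irreducible_expos c"
  shows "b = (c :: 'v expo)"
proof (rule poly_mapping_eqI)
  fix i
  show "lookup b i = lookup c i"
    using assms irreducible_expos_subset_iff[of b c] irreducible_expos_subset_iff[of c b]
    by (metis antisym less_one linorder_not_le order_refl)
qed

text \<open>If no irreducible ideal of \<open>b \<in> A\<close> lies in that of \<open>c\<close>, then the monomial with exponents one
  below those of \<open>c\<close> on the support of \<open>c\<close>, and as large as necessary elsewhere, is in all of the former
  ideals but not in the latter.\<close>

lemma irreducible_expos_prime:
  fixes c :: "'v::finite expo"
  assumes "finite A" "(\<Inter>b\<in>A. irreducible_expos b) \<subseteq> irreducible_expos c"
  obtains b where "b \<in> A" "irreducible_expos b \<subseteq> irreducible_expos c"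
proof (rule ccontr)
  assume "\<not> thesis"
  with that have no: "\<not> irreducible_expos b \<subseteq> irreducible_expos c" if "b \<in> A" for b
    using \<open>b \<in> A\<close> by blast
  define m :: "'v expo" where
    "m = Abs_poly_mapping (\<lambda>k. if lookup c k = 0 then \<Sum>b\<in>A. lookup b k else lookup c k - 1)"
  have m: "lookup m k = (if lookup c k = 0 then \<Sum>b\<in>A. lookup b k else lookup c k - 1)" for k
    unfolding m_def by (subst lookup_Abs_poly_mapping) auto
  have "m \<in> irreducible_expos b" if b: "b \<in> A" for b
  proof -
    obtain k where k: "1 \<le> lookup b k" "lookup c k = 0 \<or> lookup b k < lookup c k"
      using no[OF b] unfolding irreducible_expos_subset_iff by (auto simp: not_le)
    have "lookup b k \<le> lookup m k"
    proof (cases "lookup c k = 0")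
      case True
      thus ?thesis using member_le_sum[of b A "\<lambda>b. lookup b k"] b assms(1) by (simp add: m)
    qed (use k in \<open>auto simp: m\<close>)
    with k(1) show ?thesis by (auto simp: irreducible_expos_def)
  qed
  with assms(2) have "m \<in> irreducible_expos c" by blast
  thus False by (auto simp: irreducible_expos_def m split: if_splits)
qed

text \<open>For any other decomposition, each component of the first contains a component of the second, which
  in turn contains a component of the first. In an antichain the three coincide, so the antichain is
  contained in every finite decomposition; this gives both irredundancy and uniqueness.\<close>

lemma irreducible_decomposition_antichain:
  fixes A :: "'v::{finite,linorder} expo set"
  assumes fin: "finite A" and nonzero: "0 \<notin> A"
    and antichain: "\<And>b c. b \<in> A \<Longrightarrow> c \<in> A \<Longrightarrow> irreducible_expos b \<subseteq> irreducible_expos c \<Longrightarrow> b = c"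
  shows "irreducible_decomposition (\<Inter>b\<in>A. irreducible_ideal b :: ('v, 'k::field) mpoly set) = A"
proof -
  have inter: "(\<Inter>b\<in>B. irreducible_ideal b :: ('v, 'k) mpoly set) =
      span_monomials (\<Inter>b\<in>B. irreducible_expos b)" for B
    unfolding irreducible_ideal_eq span_monomials_def by blast
  have least: "A \<subseteq> B" if B: "finite B" "(\<Inter>b\<in>B. irreducible_expos b) = (\<Inter>b\<in>A. irreducible_expos b)" for B
  proof
    fix b assume b: "b \<in> A"
    hence "(\<Inter>b\<in>B. irreducible_expos b) \<subseteq> irreducible_expos b" using B(2) by blast
    then obtain c where c: "c \<in> B" "irreducible_expos c \<subseteq> irreducible_expos b"
      by (rule irreducible_expos_prime[OF B(1)])
    hence "(\<Inter>b\<in>A. irreducible_expos b) \<subseteq> irreducible_expos c" using B(2) by blast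
    then obtain b' where b': "b' \<in> A" "irreducible_expos b' \<subseteq> irreducible_expos c"
      by (rule irreducible_expos_prime[OF fin])
    with c(2) have "b' = b" using antichain[OF b'(1) b] by blast
    with b'(2) c(2) have "irreducible_expos c = irreducible_expos b" by blast
    with c(1) show "b \<in> B" using irreducible_expos_inj by blast
  qed
  show ?thesis
    unfolding irreducible_decomposition_def inter span_monomials_eq_iff
  proof (rule the_equality)
    have "(\<Inter>b\<in>B. irreducible_expos b) \<noteq> (\<Inter>b\<in>A. irreducible_expos b)" if "B \<subset> A" for B
      using least[of B] finite_subset[of B A] fin that by blast
    thus "finite A \<and> 0 \<notin> A \<and> (\<Inter>b\<in>A. irreducible_expos b) = (\<Inter>b\<in>A. irreducible_expos b) \<and>
      (\<forall>B\<subset>A. (\<Inter>b\<in>B. irreducible_expos b) \<noteq> (\<Inter>b\<in>A. irreducible_expos b))"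
      using fin nonzero by blast
  next
    fix B assume "finite B \<and> 0 \<notin> B \<and> (\<Inter>b\<in>B. irreducible_expos b) = (\<Inter>b\<in>A. irreducible_expos b) \<and>
      (\<forall>C\<subset>B. (\<Inter>b\<in>C. irreducible_expos b) \<noteq> (\<Inter>b\<in>A. irreducible_expos b))"
    thus "B = A" using least[of B] by blast
  qed
qed

section \<open>The polyhedra of the dual ideal\<close>

context oriented_edges
begin

definition edge_expo :: "'v \<times> 'v \<Rightarrow> 'v expo" where
  "edge_expo = (\<lambda>(i, j). Poly_Mapping.single i 1 + Poly_Mapping.single j (w j))"

lemma lookup_edge_expo:
  assumes "(i, j) \<in> ED"
  shows "lookup (edge_expo (i, j)) k = (if k = i then 1 else if k = j then w j else 0)"
  using loopless[OF assms] by (auto simp: edge_expo_def lookup_add lookup_single when_def)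

lemma irreducible_expos_edge:
  assumes "(i, j) \<in> ED"
  shows "irreducible_expos (edge_expo (i, j)) = edge_expos i j (w j)"
proof -
  have "a \<in> irreducible_expos (edge_expo (i, j)) \<longleftrightarrow> a \<in> edge_expos i j (w j)" for a
    using loopless[OF assms] weight_pos[of j]
    by (auto simp: irreducible_expos_def edge_expos_def lookup_edge_expo[OF assms] split: if_splits)
  thus ?thesis by blast
qed

lemma irreducible_decomposition_dual:
  "irreducible_decomposition (dual_edge_ideal ED w :: ('v, 'k::field) mpoly set) = edge_expo ` ED"
proof -
  have "(dual_edge_ideal ED w :: ('v, 'k) mpoly set) = (\<Inter>b\<in>edge_expo ` ED. irreducible_ideal b)"
    unfolding dual_edge_ideal_def edge_genideal irreducible_ideal_eq
    using irreducible_expos_edge by fastforce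
  moreover have "irreducible_decomposition (\<Inter>b\<in>edge_expo ` ED. irreducible_ideal b :: ('v, 'k) mpoly set) =
      edge_expo ` ED"
  proof (rule irreducible_decomposition_antichain)
    show "0 \<notin> edge_expo ` ED"
    proof
      assume "0 \<in> edge_expo ` ED"
      then obtain i j where ij: "(i, j) \<in> ED" "edge_expo (i, j) = 0" by force
      from lookup_edge_expo[OF ij(1), of i] ij(2) show False by simp
    qed
    fix b c assume "b \<in> edge_expo ` ED" "c \<in> edge_expo ` ED"
      and sub: "irreducible_expos b \<subseteq> irreducible_expos c"
    then obtain i j k l where b: "(i, j) \<in> ED" "b = edge_expo (i, j)"
      and c: "(k, l) \<in> ED" "c = edge_expo (k, l)" by force
    have "1 \<le> lookup c i" "1 \<le> lookup c j"
      using sub b(2) weight_pos[of j] lookup_edge_expo[OF b(1)]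
      unfolding irreducible_expos_subset_iff by (metis order_refl)+
    hence "{i, j} \<subseteq> {k, l}"
      by (auto simp: c(2) lookup_edge_expo[OF c(1)] split: if_splits)
    from edge_unique[OF c(1) b(1) this] show "b = c" by (simp add: b(2) c(2))
  qed simp
  ultimately show ?thesis by simp
qed

lemma inner_expo_inverse_edge:
  assumes "(i, j) \<in> ED"
  shows "x \<bullet> expo_inverse (edge_expo (i, j)) = x $ i + x $ j / real (w j)"
proof -
  have "x \<bullet> expo_inverse (edge_expo (i, j)) =
      (\<Sum>k\<in>UNIV. (if k = i then x $ i else 0) + (if k = j then x $ j / real (w j) else 0))"
    unfolding inner_vec_def
    by (rule sum.cong)
       (use loopless[OF assms] weight_pos[of j] in
         \<open>auto simp: expo_inverse_def lookup_edge_expo[OF assms] divide_inverse\<close>)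
  thus ?thesis by (simp add: sum.distrib)
qed

lemma irreducible_polyhedron_dual:
  "irreducible_polyhedron (dual_edge_ideal ED w :: ('v, 'k::field) mpoly set) =
     {x. 0 \<le> x \<and> (\<forall>(i, j)\<in>ED. 1 \<le> x $ i + x $ j / real (w j))}"
  unfolding irreducible_polyhedron_def irreducible_decomposition_dual
  using inner_expo_inverse_edge by fastforce

definition symbolic_expos :: "nat \<Rightarrow> 'v expo set" where
  "symbolic_expos n = {a. \<forall>(i, j)\<in>ED. n * w j \<le> w j * lookup a i + lookup a j}"

lemma symbolic_power_eq_span:
  "symbolic_power (dual_edge_ideal ED w :: ('v, 'k::field) mpoly set) n = span_monomials (symbolic_expos n)"
  unfolding symbolic_power_dual_edge_ideal order_ideal_def span_monomials_def symbolic_expos_def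
  using weight_edge_weights[OF loopless] by fastforce

lemma ideal_power_eq_symbolic_power_iff:
  "ideal_power mpoly_ring (dual_edge_ideal ED w :: ('v, 'k::field) mpoly set) n =
     symbolic_power (dual_edge_ideal ED w) n \<longleftrightarrow> sumset_power dual_expos n = symbolic_expos n"
  unfolding symbolic_power_eq_span ideal_power_dual_edge_ideal span_monomials_eq_iff ..

lemma sumset_power_subset_symbolic_expos: "sumset_power dual_expos n \<subseteq> symbolic_expos n"
proof
  fix a assume "a \<in> sumset_power dual_expos n"
  \<comment> \<open>The inclusion of exponents does not refer to a coefficient field; any field serves here.\<close>
  hence "(monomial a :: ('v, rat) mpoly) \<in> ideal_power mpoly_ring (dual_edge_ideal ED w) n"
    by (simp only: ideal_power_dual_edge_ideal monomial_mem_span_iff)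
  hence "(monomial a :: ('v, rat) mpoly) \<in> symbolic_power (dual_edge_ideal ED w) n"
    unfolding symbolic_power_dual_edge_ideal using ideal_power_dual_subset by fast
  thus "a \<in> symbolic_expos n" by (simp add: symbolic_power_eq_span)
qed

text \<open>Dividing \<open>n w\<^sub>j \<le> w\<^sub>j a\<^sub>i + a\<^sub>j\<close> by \<open>n w\<^sub>j\<close> gives the inequality of the edge at \<open>a / n\<close>.\<close>

lemma symbolic_expos_iff_irreducible_polyhedron:
  assumes "n \<ge> 1"
  shows "a \<in> symbolic_expos n \<longleftrightarrow>
    expo_vec a /\<^sub>R real n \<in> irreducible_polyhedron (dual_edge_ideal ED w :: ('v, 'k::field) mpoly set)"
proof -
  have "n * w j \<le> w j * lookup a i + lookup a j \<longleftrightarrow>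
      1 \<le> (expo_vec a /\<^sub>R real n) $ i + (expo_vec a /\<^sub>R real n) $ j / real (w j)" for i j
  proof -
    have pos: "real n > 0" "real (w j) > 0" using assms weight_pos[of j] by auto
    have "n * w j \<le> w j * lookup a i + lookup a j \<longleftrightarrow>
        real n * real (w j) \<le> real (w j) * real (lookup a i) + real (lookup a j)"
      by (simp flip: of_nat_mult of_nat_add)
    also have "\<dots> \<longleftrightarrow> 1 \<le> (expo_vec a /\<^sub>R real n) $ i + (expo_vec a /\<^sub>R real n) $ j / real (w j)"
      using pos by (simp add: field_simps)
    finally show ?thesis .
  qed
  moreover have "0 \<le> expo_vec a /\<^sub>R real n" by (simp add: less_eq_vec_def)
  ultimately show ?thesis
    unfolding symbolic_expos_def irreducible_polyhedron_dual by simp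
qed

text \<open>The irreducible polyhedron is convex, closed under increasing coordinates, and contains the
  generators.\<close>

lemma newton_polyhedron_subset_irreducible_polyhedron:
  "newton_polyhedron (dual_edge_ideal ED w :: ('v, 'k::field) mpoly set) \<subseteq>
     irreducible_polyhedron (dual_edge_ideal ED w :: ('v, 'k) mpoly set)" (is "_ \<subseteq> ?IP")
proof -
  have half: "convex {x :: (real, 'v) vec. 1 \<le> x $ i + x $ j / real (w j)}" for i j
  proof -
    have "{x :: (real, 'v) vec. 1 \<le> x $ i + x $ j / real (w j)} =
        {x. (axis i 1 + axis j (1 / real (w j))) \<bullet> x \<ge> 1}"
      by (simp add: inner_add_left inner_axis')
    thus ?thesis by (simp add: convex_halfspace_ge)
  qed
  have "?IP = {x. 0 \<le> x} \<inter> (\<Inter>(i, j)\<in>ED. {x. 1 \<le> x $ i + x $ j / real (w j)})"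
    unfolding irreducible_polyhedron_dual by auto
  hence convex: "convex ?IP"
    using half by (auto intro!: convex_Int convex_nonneg_vec convex_INT)
  have "expo_vec ` minimal_expos dual_expos \<subseteq> ?IP"
  proof clarify
    fix a assume "a \<in> minimal_expos dual_expos"
    hence "a \<in> sumset_power dual_expos 1"
      using sumset_power_1[OF upclosed_dual_expos] by (simp add: minimal_expos_def)
    thus "expo_vec a \<in> ?IP"
      using sumset_power_subset_symbolic_expos[of 1] symbolic_expos_iff_irreducible_polyhedron[of 1 a, where 'k='k]
      by auto
  qed
  hence hull: "convex hull (expo_vec ` minimal_expos dual_expos) \<subseteq> ?IP"
    using convex by (rule hull_minimal)
  show ?thesis
    unfolding dual_edge_ideal_eq newton_polyhedron_eq[OF upclosed_dual_expos]
    unfolding dual_edge_ideal_eq[symmetric]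
  proof
    fix z assume "z \<in> {x. 0 \<le> x} + convex hull (expo_vec ` minimal_expos dual_expos)"
    then obtain x y where xy: "z = x + y" "0 \<le> x" "y \<in> ?IP" using hull by (auto simp: set_plus_def)
    have "1 \<le> z $ i + z $ j / real (w j)" if "(i, j) \<in> ED" for i j
    proof -
      have "1 \<le> y $ i + y $ j / real (w j)"
        using xy(3) that unfolding irreducible_polyhedron_dual by blast
      also have "\<dots> \<le> z $ i + z $ j / real (w j)"
        using xy(2) by (intro add_mono divide_right_mono) (auto simp: xy(1) less_eq_vec_def)
      finally show ?thesis .
    qed
    moreover have "0 \<le> z" using xy unfolding irreducible_polyhedron_dual by (simp add: less_eq_vec_def)
    ultimately show "z \<in> ?IP" unfolding irreducible_polyhedron_dual by blast
  qed
qed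

text \<open>A rational point with denominator \<open>n\<close> of the irreducible polyhedron comes from a monomial of the
  \<open>n\<close>-th symbolic power, and by assumption this monomial lies in the \<open>n\<close>-th power. Rounding up the
  coordinates of any point does not leave the polyhedron, so rational points are dense in it, and the
  Newton polyhedron is closed.\<close>

lemma irreducible_polyhedron_subset_newton_polyhedron:
  assumes "\<And>n. n \<ge> 1 \<Longrightarrow> symbolic_expos n \<subseteq> sumset_power dual_expos n"
  shows "irreducible_polyhedron (dual_edge_ideal ED w :: ('v, 'k::field) mpoly set) \<subseteq>
     newton_polyhedron (dual_edge_ideal ED w :: ('v, 'k) mpoly set)" (is "?IP \<subseteq> ?NP")
proof
  fix x assume x: "x \<in> ?IP"
  hence x0: "0 \<le> x $ i" for i
    unfolding irreducible_polyhedron_dual by (simp add: less_eq_vec_def)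
  define p :: "nat \<Rightarrow> 'v expo" where
    "p n = Abs_poly_mapping (\<lambda>i. nat \<lceil>real (Suc n) * x $ i\<rceil>)" for n
  have lookup_p: "lookup (p n) i = nat \<lceil>real (Suc n) * x $ i\<rceil>" for n i
    unfolding p_def by (subst lookup_Abs_poly_mapping) auto
  let ?y = "\<lambda>n. expo_vec (p n) /\<^sub>R real (Suc n)"
  have y: "x $ i \<le> ?y n $ i" "?y n $ i \<le> x $ i + 1 / real (Suc n)" for n i
  proof -
    define S where "S = real (Suc n)"
    have S: "S > 0" by (simp add: S_def)
    have "S * x $ i \<le> real (lookup (p n) i)" "real (lookup (p n) i) \<le> S * x $ i + 1"
      using of_nat_ceiling[of "S * x $ i"] ceiling_correct[of "S * x $ i"] x0[of i] S
      unfolding lookup_p S_def[symmetric] by (simp_all add: of_nat_nat)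
    moreover have "?y n $ i = real (lookup (p n) i) / S"
      by (simp add: S_def divide_inverse mult.commute)
    ultimately show "x $ i \<le> ?y n $ i" "?y n $ i \<le> x $ i + 1 / real (Suc n)"
      using S unfolding S_def[symmetric]
      by (simp_all add: pos_le_divide_eq pos_divide_le_eq algebra_simps)
  qed
  have "?y n \<in> ?IP" for n
  proof -
    have "1 \<le> ?y n $ i + ?y n $ j / real (w j)" if "(i, j) \<in> ED" for i j
    proof -
      have "1 \<le> x $ i + x $ j / real (w j)"
        using x that unfolding irreducible_polyhedron_dual by blast
      also have "\<dots> \<le> ?y n $ i + ?y n $ j / real (w j)"
        by (intro add_mono divide_right_mono y) auto
      finally show ?thesis .
    qed
    moreover have "0 \<le> ?y n" by (simp add: less_eq_vec_def)
    ultimately show ?thesis unfolding irreducible_polyhedron_dual by blast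
  qed
  hence "p n \<in> sumset_power dual_expos (Suc n)" for n
    using assms[of "Suc n"] symbolic_expos_iff_irreducible_polyhedron[of "Suc n" "p n", where 'k='k] by auto
  hence mem: "?y n \<in> ?NP" for n
    using sumset_power_newton_polyhedron[OF upclosed_dual_expos, of "Suc n" "p n", where 'k='k]
    unfolding dual_edge_ideal_eq by simp
  have lim: "?y \<longlonglongrightarrow> x"
  proof (rule vec_tendstoI)
    fix i
    have "(\<lambda>n. x $ i + 1 / real (Suc n)) \<longlonglongrightarrow> x $ i + 0"
      by (intro tendsto_add tendsto_const LIMSEQ_Suc[OF lim_1_over_n])
    hence lim: "(\<lambda>n. x $ i + 1 / real (Suc n)) \<longlonglongrightarrow> x $ i" by simp
    show "(\<lambda>n. ?y n $ i) \<longlonglongrightarrow> x $ i"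
      by (rule tendsto_sandwich[OF _ _ tendsto_const lim]) (intro always_eventually allI y)+
  qed
  have "closed ?NP"
    unfolding dual_edge_ideal_eq by (rule closed_newton_polyhedron[OF upclosed_dual_expos])
  from closed_sequentially[OF this mem lim] show "x \<in> ?NP" .
qed

end

section \<open>Equality of ordinary and symbolic powers\<close>

theorem corollary4p2:
  fixes EG :: "'v::{finite,linorder} set set"
    and ED :: "('v \<times> 'v) set"
    and w :: "'v \<Rightarrow> nat"
    and J :: "('v, 'k::field) mpoly set"
  assumes "weighted_oriented_graph EG ED w"
    and "J = dual_edge_ideal ED w"
  shows "(\<forall>n\<ge>1. ideal_power mpoly_ring J n = symbolic_power J n) \<longleftrightarrow>
         normal_ideal mpoly_ring J \<and> newton_polyhedron J = irreducible_polyhedron J"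
proof -
  interpret oriented_edges ED w
    by (rule weighted_oriented_graph_imp_oriented_edges[OF assms(1)])
  note J = assms(2)
  note up = upclosed_dual_expos
  show ?thesis
  proof (intro iffI conjI)
    assume eq: "\<forall>n\<ge>1. ideal_power mpoly_ring J n = symbolic_power J n"
    show "normal_ideal mpoly_ring J"
      unfolding normal_ideal_def
    proof (intro allI impI equalityI)
      fix n :: nat assume n: "n \<ge> 1"
      show "ideal_power mpoly_ring J n \<subseteq> integral_closure mpoly_ring (ideal_power mpoly_ring J n)"
        unfolding J ideal_power_dual_edge_ideal
        by (intro ideal_subset_integral_closure ideal_span_monomials upclosed_sumset_power up)
      show "integral_closure mpoly_ring (ideal_power mpoly_ring J n) \<subseteq> ideal_power mpoly_ring J n"
        using integral_closure_subset_symbolic_power[of n, where 'k='k] eq n unfolding J by blast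
    qed
    have "symbolic_expos n \<subseteq> sumset_power dual_expos n" if "n \<ge> 1" for n
      using eq that unfolding J ideal_power_eq_symbolic_power_iff by blast
    thus "newton_polyhedron J = irreducible_polyhedron J"
      unfolding J
      by (intro equalityI newton_polyhedron_subset_irreducible_polyhedron
          irreducible_polyhedron_subset_newton_polyhedron)
  next
    assume *: "normal_ideal mpoly_ring J \<and> newton_polyhedron J = irreducible_polyhedron J"
    show "\<forall>n\<ge>1. ideal_power mpoly_ring J n = symbolic_power J n"
      unfolding J ideal_power_eq_symbolic_power_iff
    proof (intro allI impI equalityI sumset_power_subset_symbolic_expos subsetI)
      fix n :: nat and a assume n: "n \<ge> 1" and a: "a \<in> symbolic_expos n"
      have "expo_vec a /\<^sub>R real n \<in> newton_polyhedron J"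
        using a * unfolding symbolic_expos_iff_irreducible_polyhedron[OF n, where 'k='k] J by simp
      then obtain N where N: "N \<ge> 1" "(\<Sum>_<N. a) \<in> sumset_power dual_expos (n * N)"
        unfolding J dual_edge_ideal_eq by (rule newton_polyhedron_imp_multiple[OF up n])
      have "(monomial a :: ('v, 'k) mpoly) \<in>
          integral_closure mpoly_ring (span_monomials (sumset_power dual_expos n))"
        by (rule monomial_integral[OF upclosed_sumset_power[OF up] N(1)])
           (simp add: sumset_power_mult[OF up] N(2))
      also have "\<dots> = ideal_power mpoly_ring J n"
        using * n unfolding normal_ideal_def J ideal_power_dual_edge_ideal by simp
      finally show "a \<in> sumset_power dual_expos n"
        unfolding J ideal_power_dual_edge_ideal by simp
    qed
  qed
qed

end
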